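(* Let $H(y)=\frac{1}{4\pi}e^{-|y|^2/4}$, $y\in\mathbb R^2$, and let $u_\varepsilon$ be the first discrete Green function on $\mathbb R^2_\varepsilon$. For each integer $J\ge 0$ there are functions $H_{Jn}:\mathbb R^2\to\mathbb R$, $n=0,1,2,\dots$, not depending on $\varepsilon,x,t$, such that $H_{J0}=\Delta^J H$ with $\Delta=\frac{\partial^2}{\partial y_1^2}+\frac{\partial^2}{\partial y_2^2}$, each $H_{Jn}$ with $n\ge 1$ is a finite linear combination of partial derivatives of $H$, and the following holds. For every $t_0>0$ and every integer $N\ge 1$ there is a constant $R_u(J,N,t_0)\ge 0$ such that for all $\varepsilon>0$, all $x\in\mathbb R^2_\varepsilon$ and all $t\ge t_0\varepsilon^2$, $$\frac{\partial^J u_\varepsilon(x,t)}{\partial t^J}=\sum_{n=0}^{N-1}\frac{\varepsilon^{2n}}{t^{n+1+J}}\,H_{Jn}\!\left(\frac{x}{t^{1/2}}\right)+\mathbf r_u^\varepsilon(J,N,t_0;x,t),\qquad |\mathbf r_u^\varepsilon(J,N,t_0;x,t)|\le \frac{\varepsilon^{2N}R_u(J,N,t_0)}{t^{N+1+J}},$$ where $R_u(J,N,t_0)$ does not depend on $x\in\mathbb R^2_\varepsilon$, $t\ge t_0\varepsilon^2$, or $\varepsilon>0$.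
   Context: For $\varepsilon>0$ let $\mathbb R^2_\varepsilon=\{x\in\mathbb R^2: x=\varepsilon s,\ s\in\mathbb Z^2\}$. The discrete Laplacian is $$\Delta_\varepsilon w(x)=\varepsilon^{-2}\big(w(x_1+\varepsilon,x_2)+w(x_1-\varepsilon,x_2)+w(x_1,x_2+\varepsilon)+w(x_1,x_2-\varepsilon)-4w(x)\big),$$ and the grid delta-function is $\delta_\varepsilon(0)=\varepsilon^{-2}$, $\delta_\varepsilon(x)=0$ for $x\in\mathbb R^2_\varepsilon\setminus\{0\}$. The first discrete Green function $u_\varepsilon(x,t)$, $x\in\mathbb R^2_\varepsilon$, $t\ge0$, is the function such that $u_\varepsilon(\cdot,t)$ is a rapidly decreasing grid function (decaying faster than any power of $|x|$) for all $t\ge 0$, $u_\varepsilon(x,\cdot)\in C^1[0,\infty)$ for all $x$, $\dot u_\varepsilon(x,t)-\Delta_\varepsilon u_\varepsilon(x,t)=0$ for $x\in\mathbb R^2_\varepsilon$, $t>0$ (the dot is $\partial/\partial t$ and $\Delta_\varepsilon$ acts in $x$), and $u_\varepsilon(x,0)=\delta_\varepsilon(x)$. It has the explicit representation $$u_\varepsilon(x,t)=\frac1{(2\pi)^2}\int_{\{|\eta_1|,|\eta_2|\le\pi/\varepsilon\}}e^{-t\varepsilon^{-2}A(\eta\varepsilon)}e^{i x\cdot\eta}\,d\eta,\qquad A(\xi)=2(2-\cos\xi_1-\cos\xi_2).$$ *)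

theory Defs
  imports "HOL-Analysis.Analysis"
begin

definition grid :: "real \<Rightarrow> (real^2) set" where
  "grid \<epsilon> = {x. \<exists>s :: int^2. x = \<epsilon> *\<^sub>R (\<chi> i. real_of_int (s $ i))}"

definition discrete_laplacian :: "real \<Rightarrow> (real^2 \<Rightarrow> real) \<Rightarrow> real^2 \<Rightarrow> real" where
  "discrete_laplacian \<epsilon> w x =
     (w (x + axis 1 \<epsilon>) + w (x - axis 1 \<epsilon>) + w (x + axis 2 \<epsilon>) + w (x - axis 2 \<epsilon>) - 4 * w x) / \<epsilon>\<^sup>2"

definition grid_delta :: "real \<Rightarrow> real^2 \<Rightarrow> real" where
  "grid_delta \<epsilon> x = (if x = 0 then 1 / \<epsilon>\<^sup>2 else 0)"

definition rapidly_decreasing_on_grid :: "real \<Rightarrow> (real^2 \<Rightarrow> real) \<Rightarrow> bool" where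
  "rapidly_decreasing_on_grid \<epsilon> w \<longleftrightarrow>
     (\<forall>k::nat. \<exists>C. \<forall>x \<in> grid \<epsilon>. norm x ^ k * \<bar>w x\<bar> \<le> C)"

(* Membership in C^1[0,oo), with the one-sided derivative at 0: values at negative
   arguments play no role, unlike in C1_differentiable_on. *)
definition C1_nonneg :: "(real \<Rightarrow> real) \<Rightarrow> bool" where
  "C1_nonneg f \<longleftrightarrow>
     (\<exists>f'. (\<forall>t\<ge>0. (f has_real_derivative f' t) (at t within {0..})) \<and> continuous_on {0..} f')"

(* Grid functions are represented by functions on the whole plane, and functions of
   t >= 0 by functions on the whole line; the conditions only constrain the values
   of u x t with x in the grid and t >= 0, so u is unique there and arbitrary elsewhere. *)
definition first_green_function :: "real \<Rightarrow> (real^2 \<Rightarrow> real \<Rightarrow> real) \<Rightarrow> bool" where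
  "first_green_function \<epsilon> u \<longleftrightarrow>
     (\<forall>t\<ge>0. rapidly_decreasing_on_grid \<epsilon> (\<lambda>x. u x t)) \<and>
     (\<forall>x \<in> grid \<epsilon>. C1_nonneg (u x)) \<and>
     (\<forall>x \<in> grid \<epsilon>. \<forall>t>0. deriv (u x) t - discrete_laplacian \<epsilon> (\<lambda>z. u z t) x = 0) \<and>
     (\<forall>x \<in> grid \<epsilon>. u x 0 = grid_delta \<epsilon> x)"

definition heat_profile :: "real^2 \<Rightarrow> real" where
  "heat_profile y = 1 / (4 * pi) * exp (- (norm y)\<^sup>2 / 4)"

definition partial_deriv :: "2 \<Rightarrow> (real^2 \<Rightarrow> real) \<Rightarrow> real^2 \<Rightarrow> real" where
  "partial_deriv i f y = deriv (\<lambda>h. f (y + axis i h)) 0"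

definition laplacian :: "(real^2 \<Rightarrow> real) \<Rightarrow> real^2 \<Rightarrow> real" where
  "laplacian f y = partial_deriv 1 (partial_deriv 1 f) y + partial_deriv 2 (partial_deriv 2 f) y"

(* The pair (a, b) stands for the partial derivative of order a in the first and b in
   the second variable. Order zero, i.e. g itself, is not admitted. *)
definition lin_comb_of_partials :: "(real^2 \<Rightarrow> real) \<Rightarrow> (real^2 \<Rightarrow> real) \<Rightarrow> bool" where
  "lin_comb_of_partials f g \<longleftrightarrow>
     (\<exists>(S :: (nat \<times> nat) set) (c :: nat \<Rightarrow> nat \<Rightarrow> real).
        finite S \<and> (0, 0) \<notin> S \<and>
        (\<forall>y. f y = (\<Sum>(a, b)\<in>S. c a b * (partial_deriv 1 ^^ a) ((partial_deriv 2 ^^ b) g) y)))"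

end

theory Submission
  imports Defs "HOL-Probability.Characteristic_Functions"
begin

text \<open>The Green function at time \<open>t\<close> depends, up to scaling, only on \<open>x / \<epsilon>\<close> and
\<open>\<tau> = t / \<epsilon>\<^sup>2\<close>, so an expansion in powers of \<open>\<epsilon>\<^sup>2 / t\<close> is a large-time expansion in powers of
\<open>1 / \<tau>\<close> for the walk on the unit lattice. The Fourier integral of that walk factorizes into two
one-dimensional integrals, and everything reduces to dimension one.

In dimension one, the substitution \<open>\<xi> = p / sqrt \<tau>\<close> turns the exponent
\<open>\<tau> * 2 * (1 - cos \<xi>)\<close> into \<open>p\<^sup>2 * psi (p\<^sup>2 / \<tau>)\<close> with an entire function \<open>psi\<close>,
\<open>psi 0 = 1\<close>. The integrand is therefore smooth in \<open>d = 1 / \<tau>\<close> up to \<open>d = 0\<close>, where it becomes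
Gaussian. All its \<open>d\<close>-derivatives are finite sums of terms \<open>p ^ (2 * a) * \<Theta> (p\<^sup>2 * d)\<close> times the
same exponential, and these have a Gaussian majorant on the whole domain \<open>\<bar>p\<bar> \<le> pi * sqrt \<tau>\<close>,
since \<open>psi\<close> is bounded below on \<open>{0..pi\<^sup>2}\<close>. Taylor's formula in \<open>d\<close>, integrated in \<open>p\<close>, gives
\<open>walk_kernel_expansion\<close>: the coefficients are Fourier transforms of even polynomials times
\<open>exp (- p\<^sup>2)\<close>, that is, combinations of even derivatives of the one-dimensional Gaussian, with a
remainder uniform in the position. Time derivatives only insert powers of the symbol. The Leibniz rule
and \<open>expansion_product\<close> then yield the planar expansion \<open>walk_kernel2_expansion\<close>.

It remains to identify an arbitrary Green function with the explicit formula. Its rapid decay is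
assumed separately at each time, so uniqueness needs more than an energy estimate: a Baire category
argument in \<open>pointwise_bounded_flow_zero\<close> shows that a solution that is bounded in space at each time
is bounded locally uniformly in time, and then it is determined by its initial values.\<close>

section \<open>Uniqueness for flows with bounded generator\<close>

text \<open>The generator has norm at most \<open>K\<close> for the supremum norm, so on a time interval of length
at most \<open>1 / (2 * K)\<close> the solution moves by at most half of its own supremum. Hence the
supremum over the interval is at most twice the supremum at any single time \<open>s\<close> in it, earlier
or later. The a priori bound \<open>M\<close> makes that supremum finite, so that its half
can be absorbed.\<close>

lemma bounded_flow_growth:
  fixes w :: "'a \<Rightarrow> real \<Rightarrow> real"
  assumes cont: "\<And>x. x \<in> X \<Longrightarrow> continuous_on {a..b} (w x)"
    and der: "\<And>x t. x \<in> X \<Longrightarrow> a < t \<Longrightarrow> t < b \<Longrightarrow> (w x has_real_derivative D x t) (at t)"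
    and gen: "\<And>x t M. x \<in> X \<Longrightarrow> a < t \<Longrightarrow> t < b \<Longrightarrow> (\<forall>z\<in>X. \<bar>w z t\<bar> \<le> M) \<Longrightarrow> \<bar>D x t\<bar> \<le> K * M"
    and short: "K * (b - a) \<le> 1 / 2" and K: "K \<ge> 0"
    and bdd: "\<And>x t. x \<in> X \<Longrightarrow> t \<in> {a..b} \<Longrightarrow> \<bar>w x t\<bar> \<le> M"
    and s: "s \<in> {a..b}" and ref: "\<And>x. x \<in> X \<Longrightarrow> \<bar>w x s\<bar> \<le> B"
    and x: "x \<in> X" and t: "t \<in> {a..b}"
  shows "\<bar>w x t\<bar> \<le> 2 * B"
proof -
  have M0: "0 \<le> M" using bdd[OF x t] by linarith
  \<comment> \<open>By the mean value theorem, any bound \<open>L\<close> on the interval improves to \<open>B + L / 2\<close>.\<close>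
  have step: "\<forall>x\<in>X. \<forall>t\<in>{a..b}. \<bar>w x t\<bar> \<le> B + L / 2"
    if L: "\<forall>x\<in>X. \<forall>t\<in>{a..b}. \<bar>w x t\<bar> \<le> L" and L0: "0 \<le> L" for L
  proof (intro ballI)
    fix x t assume x: "x \<in> X" and t: "t \<in> {a..b}"
    have diff: "\<bar>w x q - w x p\<bar> \<le> L / 2" if pq: "p < q" "a \<le> p" "q \<le> b" for p q
    proof -
      obtain z where z: "p < z" "z < q" "w x q - w x p = (q - p) * D x z"
      proof -
        have "continuous_on {p..q} (w x)"
          using cont[OF x] by (rule continuous_on_subset) (use pq in auto)
        moreover have "(w x has_real_derivative D x y) (at y)" if "p < y" "y < q" for y
          using der[OF x] that pq by auto
        ultimately obtain l z where "p < z" "z < q" "(w x has_real_derivative l) (at z)" "w x q - w x p = (q - p) * l"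
          using MVT[OF pq(1), of "w x"] by (auto simp: real_differentiable_def)
        with der[OF x, of z] pq have "l = D x z" by (intro DERIV_unique) auto
        then show ?thesis using that \<open>p < z\<close> \<open>z < q\<close> \<open>w x q - w x p = (q - p) * l\<close> by blast
      qed
      have "\<bar>D x z\<bar> \<le> K * L" using gen[OF x, of z L] L z pq by auto
      then have "\<bar>w x q - w x p\<bar> \<le> (b - a) * (K * L)"
        using z pq by (auto simp: abs_mult intro!: mult_mono)
      also have "\<dots> = (K * (b - a)) * L" by simp
      also have "\<dots> \<le> (1/2) * L" using short L0 by (intro mult_right_mono) auto
      finally show ?thesis by simp
    qed
    have "\<bar>w x t - w x s\<bar> \<le> L / 2"
      using diff[of s t] diff[of t s] s t L0 by (cases s t rule: linorder_cases) (auto simp: abs_minus_commute)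
    then show "\<bar>w x t\<bar> \<le> B + L / 2" using ref[OF x] by linarith
  qed
  have B0: "0 \<le> B" using ref[OF x] by linarith
  have "\<forall>x\<in>X. \<forall>t\<in>{a..b}. \<bar>w x t\<bar> \<le> 2 * B + M / 2 ^ n" for n
  proof (induction n)
    case 0
    then show ?case using bdd B0 by fastforce
  next
    case (Suc n)
    have "0 \<le> 2 * B + M / 2 ^ n" using B0 M0 by simp
    from step[OF Suc this] show ?case by (simp add: field_simps)
  qed
  then have "\<bar>w x t\<bar> \<le> 2 * B + M * (1 / 2) ^ n" for n
    using x t by (simp add: power_divide)
  moreover have "(\<lambda>n. 2 * B + M * (1 / 2 :: real) ^ n) \<longlonglongrightarrow> 2 * B + M * 0"
    by (intro tendsto_intros LIMSEQ_realpow_zero) auto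
  ultimately show ?thesis
    by (intro LIMSEQ_le_const[of _ "2 * B"]) auto
qed

text \<open>Compactness of the interval, in the form of the Bolzano bisection principle.\<close>

lemma locally_bounded_imp_bounded:
  fixes w :: "'a \<Rightarrow> real \<Rightarrow> real"
  assumes ab: "a \<le> b"
    and loc: "\<And>t. a \<le> t \<Longrightarrow> t \<le> b \<Longrightarrow>
      \<exists>r>0. \<exists>M. \<forall>s. 0 \<le> s \<and> \<bar>s - t\<bar> < r \<longrightarrow> (\<forall>x\<in>X. \<bar>w x s\<bar> \<le> M)"
    and a0: "0 \<le> a"
  shows "\<exists>M. \<forall>t\<in>{a..b}. \<forall>x\<in>X. \<bar>w x t\<bar> \<le> M"
proof -
  have "\<exists>M. \<forall>t\<in>{a..b}. 0 \<le> t \<longrightarrow> (\<forall>x\<in>X. \<bar>w x t\<bar> \<le> M)"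
    using ab
  proof (induction rule: Bolzano)
    case (trans p q r)
    then obtain M1 M2 where M: "\<forall>t\<in>{p..q}. 0 \<le> t \<longrightarrow> (\<forall>x\<in>X. \<bar>w x t\<bar> \<le> M1)" 
       "\<forall>t\<in>{q..r}. 0 \<le> t \<longrightarrow> (\<forall>x\<in>X. \<bar>w x t\<bar> \<le> M2)" by blast
    show ?case
    proof (intro exI[of _ "max M1 M2"] ballI impI)
      fix t x assume "t \<in> {p..r}" "0 \<le> t" "x \<in> X"
      then show "\<bar>w x t\<bar> \<le> max M1 M2" using M by (cases "t \<le> q") (auto simp: le_max_iff_disj)
    qed
  next
    case (local t)
    from loc[OF local] obtain r M where "r > 0" "\<forall>s. 0 \<le> s \<and> \<bar>s - t\<bar> < r \<longrightarrow> (\<forall>x\<in>X. \<bar>w x s\<bar> \<le> M)"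
      by blast
    then show ?case by (intro exI[of _ r] conjI allI impI exI[of _ M]) auto
  qed
  then show ?thesis using a0 by auto
qed

text \<open>A Green function is bounded in space for each time separately, with no uniformity in time, so
the usual Gronwall argument does not apply directly. Uniformity is recovered from the Baire
category theorem. Let \<open>F\<close> be the closed set of times near which the family is not uniformly
bounded. If \<open>F\<close> were nonempty, one bound \<open>n\<close> would hold at all times of \<open>F\<close> close to some
\<open>c\<close> in \<open>F\<close>. On a gap of \<open>F\<close> near \<open>c\<close> the family is locally bounded, and the estimate
\<open>bounded_flow_growth\<close>, which works in both time directions, carries the bound \<open>n\<close> from an endpoint
of the gap across the gap. The family would then be uniformly bounded near \<open>c\<close>, which is absurd.\<close>

lemma pointwise_bounded_flow_zero:
  fixes w :: "'a \<Rightarrow> real \<Rightarrow> real"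
  assumes cont: "\<And>x. x \<in> X \<Longrightarrow> continuous_on {0..} (w x)"
    and der: "\<And>x t. x \<in> X \<Longrightarrow> 0 < t \<Longrightarrow> (w x has_real_derivative D x t) (at t)"
    and gen: "\<And>x t M. x \<in> X \<Longrightarrow> 0 < t \<Longrightarrow> (\<forall>z\<in>X. \<bar>w z t\<bar> \<le> M) \<Longrightarrow> \<bar>D x t\<bar> \<le> K * M"
    and K: "K > 0"
    and bdd: "\<And>t. 0 \<le> t \<Longrightarrow> \<exists>M. \<forall>x\<in>X. \<bar>w x t\<bar> \<le> M"
    and init: "\<And>x. x \<in> X \<Longrightarrow> w x 0 = 0"
    and x: "x \<in> X" and t: "0 \<le> t"
  shows "w x t = 0"
proof -
  define LB where "LB t \<longleftrightarrow> (\<exists>r>0. \<exists>M. \<forall>s. 0 \<le> s \<and> \<bar>s - t\<bar> < r \<longrightarrow> (\<forall>x\<in>X. \<bar>w x s\<bar> \<le> M))" for t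
  have growth: "\<bar>w x t\<bar> \<le> 2 * B" if "0 \<le> a" "K * (b - a) \<le> 1 / 2"
      "\<forall>t\<in>{a..b}. \<forall>x\<in>X. \<bar>w x t\<bar> \<le> M" "s \<in> {a..b}" "\<forall>x\<in>X. \<bar>w x s\<bar> \<le> B" "x \<in> X" "t \<in> {a..b}"
    for a b M s B x t
  proof (rule bounded_flow_growth[where X = X and w = w and D = D and K = K and M = M and s = s and a = a and b = b])
    show "continuous_on {a..b} (w y)" if "y \<in> X" for y
      using cont[OF that] by (rule continuous_on_subset) (use \<open>0 \<le> a\<close> in auto)
  qed (use that der gen K in auto)
  have Icont: "\<bar>w x q\<bar> \<le> B"
    if "a < b" "0 \<le> a" "x \<in> X" "\<And>t. a < t \<Longrightarrow> t < b \<Longrightarrow> \<bar>w x t\<bar> \<le> B" "q \<in> {a..b}" for a b x B q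
  proof -
    have cl: "closure {a<..<b} = {a..b}" using that by simp
    have "continuous_on (closure {a<..<b}) (\<lambda>t. \<bar>w x t\<bar>)"
      unfolding cl using continuous_on_subset[OF cont[OF that(3)], of "{a..b}"] that
      by (intro continuous_intros) auto
    then show ?thesis
      using continuous_on_closure_norm_le[of "{a<..<b}" "w x" B q] that cl
        continuous_on_subset[OF cont[OF that(3)], of "{a..b}"] by auto
  qed
  have all_LB: "LB t" if "0 \<le> t" for t
  proof (rule ccontr)
    assume "\<not> LB t"
    define F where "F = {t. 0 \<le> t \<and> \<not> LB t}"
    have tF: "t \<in> F" using \<open>\<not> LB t\<close> that by (simp add: F_def)
    have op: "open {t. LB t}"
      unfolding open_dist
    proof
      fix p assume "p \<in> {t. LB t}"
      then obtain r M where r: "r > 0" "\<forall>s. 0 \<le> s \<and> \<bar>s - p\<bar> < r \<longrightarrow> (\<forall>x\<in>X. \<bar>w x s\<bar> \<le> M)"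
        unfolding LB_def by blast
      show "\<exists>e>0. \<forall>y. dist y p < e \<longrightarrow> y \<in> {t. LB t}"
      proof (intro exI[of _ "r/2"] conjI allI impI)
        fix y assume "dist y p < r / 2"
        then have "\<bar>s - p\<bar> < r" if "\<bar>s - y\<bar> < r / 2" for s
          using that unfolding dist_real_def by linarith
        then have "\<forall>s. 0 \<le> s \<and> \<bar>s - y\<bar> < r / 2 \<longrightarrow> (\<forall>x\<in>X. \<bar>w x s\<bar> \<le> M)" using r by blast
        then show "y \<in> {t. LB t}" unfolding LB_def using r(1) half_gt_zero by blast
      qed (use r in auto)
    qed
    have closedF: "closed F"
    proof -
      have "F = {0..} \<inter> - {t. LB t}" by (auto simp: F_def)
      then show ?thesis using op by (metis closed_Compl closed_Int closed_atLeast)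
    qed
    define E where "E n = {t\<in>F. \<forall>x\<in>X. \<bar>w x t\<bar> \<le> real n}" for n
    have closedE: "closed (E n)" for n
    proof -
      have "closed {t\<in>F. \<bar>w x t\<bar> \<le> real n}" if "x \<in> X" for x
        using closedF continuous_on_subset[OF cont[OF that], of F]
        by (intro continuous_closed_preimage[of F "\<lambda>t. \<bar>w x t\<bar>" "{..real n}", unfolded vimage_def Int_def, simplified]
            continuous_intros) (auto simp: F_def)
      then have "closed (F \<inter> (\<Inter>x\<in>X. {t\<in>F. \<bar>w x t\<bar> \<le> real n}))"
        using closedF by (intro closed_Int closed_INT) auto
      also have "F \<inter> (\<Inter>x\<in>X. {t\<in>F. \<bar>w x t\<bar> \<le> real n}) = E n" by (auto simp: E_def)
      finally show ?thesis .
    qed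
    have cover: "\<exists>n. s \<in> E n" if "s \<in> F" for s
    proof -
      have "0 \<le> s" using that by (simp add: F_def)
      then obtain M where "\<forall>x\<in>X. \<bar>w x s\<bar> \<le> M" using bdd by blast
      moreover obtain n where "M \<le> real n" using real_arch_simple by blast
      ultimately have "s \<in> E n" using that unfolding E_def by (blast intro: order_trans)
      then show ?thesis ..
    qed
    \<comment> \<open>Baire: one of the sets \<open>E n\<close> has interior relative to \<open>F\<close>.\<close>
    have "\<exists>n. \<not> F \<subseteq> closure (F - E n)"
    proof (rule ccontr)
      assume "\<nexists>n. \<not> F \<subseteq> closure (F - E n)"
      then have "F \<subseteq> closure (\<Inter>n. F - E n)"
      proof (intro Baire closedF)
        fix T assume "T \<in> range (\<lambda>n. F - E n)"
        then obtain n where T: "T = F - E n" by blast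
        have "openin (top_of_set F) (F - E n)"
          using closedE[of n] by (metis Diff_Compl Int_commute Compl_eq_Diff_UNIV Diff_eq open_Compl openin_open_Int)
        moreover have "F \<subseteq> closure (F - E n)" using \<open>\<nexists>n. _\<close> by blast
        ultimately show "openin (top_of_set F) T \<and> F \<subseteq> closure T" by (simp add: T)
      qed auto
      moreover have "(\<Inter>n. F - E n) = {}" using cover by blast
      ultimately have "F \<subseteq> closure {}" by metis
      then show False using tF by simp
    qed
    then obtain n c where c: "c \<in> F" "c \<notin> closure (F - E n)" by blast
    then obtain r0 where r0: "r0 > 0" "\<forall>y\<in>F - E n. r0 \<le> dist y c"
      unfolding closure_approachable by (meson not_less)
    define r where "r = min r0 (1 / (2 * K))"
    have r: "r > 0" "K * r \<le> 1 / 2" "r \<le> r0"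
      using r0 K by (auto simp: r_def min_def field_simps)
    have inE: "\<bar>w x s\<bar> \<le> real n" if "s \<in> F" "\<bar>s - c\<bar> < r" "x \<in> X" for s x
    proof -
      have "s \<in> E n"
      proof (rule ccontr)
        assume "s \<notin> E n"
        then have "r0 \<le> dist s c" using r0(2) that by blast
        then show False using that r by (simp add: dist_real_def)
      qed
      then show ?thesis using that by (simp add: E_def)
    qed
    have "\<bar>w x s\<bar> \<le> 2 * real n" if s: "0 \<le> s" "\<bar>s - c\<bar> < r" and x: "x \<in> X" for s x
    proof -
      \<comment> \<open>Here \<open>e\<close> is the endpoint in \<open>F\<close> of the gap containing \<open>s\<close>, on either side of \<open>s\<close>.\<close>
      have gap: "\<bar>w x s\<bar> \<le> 2 * real n"
        if e: "e \<in> F" "\<bar>e - c\<bar> < r" "\<bar>s - e\<bar> < r" "e \<noteq> s"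
          and good: "\<And>q. min s e \<le> q \<Longrightarrow> q \<le> max s e \<Longrightarrow> q \<noteq> e \<Longrightarrow> q \<notin> F" for e
      proof -
        obtain B where B: "\<forall>x\<in>X. \<bar>w x s\<bar> \<le> B" using bdd s by blast
        have e0: "0 \<le> e" using e by (simp add: F_def)
        have short: "K * (max s e - min s e) \<le> 1 / 2"
        proof -
          have "K * (max s e - min s e) \<le> K * r" using K e by (intro mult_left_mono) auto
          then show ?thesis using r by linarith
        qed
        \<comment> \<open>A bound on the open gap that depends on \<open>B\<close> only is needed to pass to the endpoint \<open>e\<close>,
          where local boundedness fails.\<close>
        have in2B: "\<bar>w y q\<bar> \<le> 2 * B" if y: "y \<in> X" and q: "min s e < q" "q < max s e" for y q
        proof -
          have "\<exists>M. \<forall>t\<in>{min s q..max s q}. \<forall>x\<in>X. \<bar>w x t\<bar> \<le> M"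
          proof (rule locally_bounded_imp_bounded)
            fix p assume "min s q \<le> p" "p \<le> max s q"
            then have "p \<notin> F" "0 \<le> p" using good[of p] q e0 s by auto
            then show "\<exists>r>0. \<exists>M. \<forall>s. 0 \<le> s \<and> \<bar>s - p\<bar> < r \<longrightarrow> (\<forall>x\<in>X. \<bar>w x s\<bar> \<le> M)"
              by (auto simp: F_def LB_def)
          qed (use s q e0 in auto)
          then obtain M where M: "\<forall>t\<in>{min s q..max s q}. \<forall>x\<in>X. \<bar>w x t\<bar> \<le> M" by blast
          have "K * (max s q - min s q) \<le> K * (max s e - min s e)"
            using K q by (intro mult_left_mono) auto
          then show ?thesis using growth[OF _ _ M, of s B y q] B y short s q e0 by auto
        qed
        have "\<forall>q\<in>{min s e..max s e}. \<forall>x\<in>X. \<bar>w x q\<bar> \<le> 2 * B"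
          using Icont[OF _ _ _ in2B, of "min s e" "max s e"] e s e0 by auto
        from growth[OF _ short this, of e "real n" x s] show ?thesis
          using inE e x s e0 by auto
      qed
      show ?thesis
      proof (cases "s \<in> F")
        case True
        then show ?thesis using inE[OF True s(2) x] by linarith
      next
        case sF: False
        then have "s \<noteq> c" using c by auto
        then consider "s < c" | "c < s" by linarith
        then show ?thesis
        proof cases
          case 1
          define e where "e = Inf (F \<inter> {s..c})"
          have cp: "closed (F \<inter> {s..c})" using closedF by auto
          have bb: "bdd_below (F \<inter> {s..c})" by auto
          have "F \<inter> {s..c} \<noteq> {}" using c 1 by auto
          from closed_contains_Inf[OF this bb cp] have eF: "e \<in> F" "s \<le> e" "e \<le> c" by (auto simp: e_def)
          have "q \<notin> F" if "min s e \<le> q" "q \<le> max s e" "q \<noteq> e" for q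
          proof
            assume "q \<in> F"
            then have "e \<le> q" unfolding e_def using that eF by (intro cInf_lower[OF _ bb]) auto
            then show False using that eF by auto
          qed
          then show ?thesis using eF s 1 sF by (intro gap[of e]) auto
        next
          case 2
          define e where "e = Sup (F \<inter> {c..s})"
          have cp: "closed (F \<inter> {c..s})" using closedF by auto
          have bb: "bdd_above (F \<inter> {c..s})" by auto
          have "F \<inter> {c..s} \<noteq> {}" using c 2 by auto
          from closed_contains_Sup[OF this bb cp] have eF: "e \<in> F" "e \<le> s" "c \<le> e" by (auto simp: e_def)
          have "q \<notin> F" if "min s e \<le> q" "q \<le> max s e" "q \<noteq> e" for q
          proof
            assume "q \<in> F"
            then have "q \<le> e" unfolding e_def using that eF by (intro cSup_upper[OF _ bb]) auto
            then show False using that eF by auto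
          qed
          then show ?thesis using eF s 2 sF by (intro gap[of e]) auto
        qed
      qed
    qed
    then have "LB c" unfolding LB_def using r by blast
    then show False using c by (simp add: F_def)
  qed
  \<comment> \<open>The family is now bounded on compact intervals, and the zero data propagate in steps \<open>h\<close>.\<close>
  define h where "h = 1 / (2 * K)"
  have h: "h > 0" "K * h \<le> 1 / 2" using K by (auto simp: h_def)
  have "\<forall>x\<in>X. \<forall>t\<in>{0..real n * h}. w x t = 0" for n
  proof (induction n)
    case 0
    then show ?case using init by auto
  next
    case (Suc n)
    have "\<exists>M. \<forall>t\<in>{real n * h..real (Suc n) * h}. \<forall>x\<in>X. \<bar>w x t\<bar> \<le> M"
    proof (rule locally_bounded_imp_bounded)
      fix t assume "real n * h \<le> t"
      moreover have "0 \<le> real n * h" using h by simp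
      ultimately have "0 \<le> t" by linarith
      from all_LB[OF this] show "\<exists>r>0. \<exists>M. \<forall>s. 0 \<le> s \<and> \<bar>s - t\<bar> < r \<longrightarrow> (\<forall>x\<in>X. \<bar>w x s\<bar> \<le> M)"
        by (simp add: LB_def)
    qed (use h in \<open>auto simp: algebra_simps\<close>)
    then obtain M where M: "\<forall>t\<in>{real n * h..real (Suc n) * h}. \<forall>x\<in>X. \<bar>w x t\<bar> \<le> M" by blast
    show ?case
    proof (intro ballI)
      fix x t assume x: "x \<in> X" and t: "t \<in> {0..real (Suc n) * h}"
      show "w x t = 0"
      proof (cases "t \<le> real n * h")
        case True
        then show ?thesis using Suc x t by auto
      next
        case False
        have "\<bar>w x t\<bar> \<le> 2 * 0"
          by (rule growth[OF _ _ M, of "real n * h"])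
            (use Suc x t False h in \<open>auto simp: algebra_simps\<close>)
        then show ?thesis by simp
      qed
    qed
  qed
  moreover obtain n where "t / h \<le> real n" using real_arch_simple by blast
  then have "t \<in> {0..real n * h}" using t h by (simp add: field_simps)
  ultimately show ?thesis using x by blast
qed

section \<open>The rescaled symbol of the one-dimensional walk\<close>

text \<open>The power series of the entire function \<open>2 * (1 - cos (sqrt s)) / s\<close>. For the walk with symbol
\<open>2 * (1 - cos \<xi>)\<close>, the substitution \<open>\<xi> = p / sqrt \<tau>\<close> turns \<open>\<tau>\<close> times the symbol into
\<open>p\<^sup>2 * psi (p\<^sup>2 / \<tau>)\<close>, which depends smoothly on \<open>d = 1 / \<tau>\<close> up to \<open>d = 0\<close>.\<close>

definition psi_fps :: "real fps" where
  "psi_fps = Abs_fps (\<lambda>n. 2 * (-1) ^ n / fact (2 * n + 2))"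

abbreviation psi :: "real \<Rightarrow> real" where
  "psi \<equiv> eval_fps psi_fps"

lemma psi_fps_sums: "(\<lambda>n. fps_nth psi_fps n * (x\<^sup>2) ^ n * x\<^sup>2) sums (2 * (1 - cos x))"
proof -
  have "(\<lambda>n. (- 1) ^ Suc n / fact (2 * Suc n) * x ^ (2 * Suc n)) sums (cos x - 1)"
    using cos_paired[of x] by (subst sums_Suc_iff) simp
  from sums_mult[OF this, of "-2"] show ?thesis
    by (simp add: psi_fps_def power_mult power2_eq_square algebra_simps)
qed

lemma fps_conv_radius_psi [simp]: "fps_conv_radius psi_fps = \<infinity>"
  unfolding fps_conv_radius_def
proof (rule conv_radius_inftyI'')
  fix z :: real
  define x where "x = sqrt \<bar>z\<bar>"
  have x2: "x\<^sup>2 = \<bar>z\<bar>" by (simp add: x_def)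
  have "summable (\<lambda>n. inverse (fact n) * (2 * \<bar>z\<bar> ^ n))"
    using summable_exp[of "\<bar>z\<bar>"] summable_mult[of "\<lambda>n. inverse (fact n) * \<bar>z\<bar> ^ n" 2]
    by (simp add: mult_ac)
  moreover have "norm (fps_nth psi_fps n * z ^ n) \<le> inverse (fact n) * (2 * \<bar>z\<bar> ^ n)" for n
  proof -
    have "(fact n :: real) \<le> fact (2 * n + 2)" by (intro fact_mono) auto
    then have "1 / fact (2 * n + 2) \<le> (1 / fact n :: real)" by (intro frac_le) auto
    then have "1 / fact (2 * n + 2) * (2 * \<bar>z\<bar> ^ n) \<le> (1 / fact n :: real) * (2 * \<bar>z\<bar> ^ n)"
      by (intro mult_right_mono) auto
    then show ?thesis by (simp add: psi_fps_def abs_mult power_abs inverse_eq_divide del: fact_Suc)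
  qed
  ultimately show "summable (\<lambda>n. fps_nth psi_fps n * z ^ n)"
    by (rule summable_comparison_test'[where N = 0]) 
qed

lemma psi_eq: "x\<^sup>2 * psi (x\<^sup>2) = 2 * (1 - cos x)"
proof -
  have "(\<lambda>n. fps_nth psi_fps n * (x\<^sup>2) ^ n * x\<^sup>2) sums (psi (x\<^sup>2) * x\<^sup>2)"
    by (intro sums_mult2 sums_eval_fps) simp
  from sums_unique2[OF this psi_fps_sums] show ?thesis by (simp add: mult.commute)
qed

lemma psi_0 [simp]: "psi 0 = 1"
  by (simp add: eval_fps_at_0 psi_fps_def)

text \<open>The symbol vanishes on the Brillouin zone only at the origin, where it is quadratic. This
nondegeneracy yields the Gaussian decay of all integrands below.\<close>

lemma psi_lower_bound: "\<exists>b>0. \<forall>s. 0 \<le> s \<and> s \<le> pi\<^sup>2 \<longrightarrow> b \<le> psi s"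
proof -
  have "continuous_on {0..pi\<^sup>2} psi" by (intro continuous_intros) auto
  then obtain s0 where s0: "s0 \<in> {0..pi\<^sup>2}" "\<forall>s\<in>{0..pi\<^sup>2}. psi s0 \<le> psi s"
    using continuous_attains_inf[of "{0..pi\<^sup>2}" psi] by auto
  have "psi s0 > 0"
  proof (cases "s0 = 0")
    case False
    define x where "x = sqrt s0"
    have x: "0 < x" "x \<le> pi" "x\<^sup>2 = s0"
      using s0 False by (auto simp: x_def real_le_lsqrt)
    have "cos x < cos 0" using x by (intro cos_monotone_0_pi) auto
    then have "s0 * psi s0 > 0" using psi_eq[of x] x by simp
    then show ?thesis using s0 by (auto simp: zero_less_mult_iff)
  qed simp
  then show ?thesis using s0 by auto
qed

text \<open>A class of functions of momentum \<open>p\<close> and inverse time \<open>d\<close> that contains the rescaled symbols,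
is closed under differentiation in \<open>d\<close>, and whose members decay like a Gaussian in \<open>p\<close> as
long as \<open>p\<^sup>2 * d \<le> pi\<^sup>2\<close>.\<close>

inductive gaussian_symbol :: "(real \<Rightarrow> real \<Rightarrow> real) \<Rightarrow> bool" where
  monomial: "fps_conv_radius \<Theta> = \<infinity> \<Longrightarrow>
     gaussian_symbol (\<lambda>p d. p ^ (2 * a) * eval_fps \<Theta> (p\<^sup>2 * d) * exp (- p\<^sup>2 * psi (p\<^sup>2 * d)))"
| add: "gaussian_symbol F \<Longrightarrow> gaussian_symbol G \<Longrightarrow> gaussian_symbol (\<lambda>p d. F p d + G p d)"

text \<open>The chain rule produces a factor \<open>p\<^sup>2\<close> for each derivative of \<open>\<Theta>\<close> or of \<open>psi\<close>; the derivative
of the exponential contributes one more factor \<open>p\<^sup>2\<close>.\<close>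

lemma gaussian_symbol_derivative:
  assumes "gaussian_symbol G"
  shows "\<exists>G'. gaussian_symbol G' \<and> (\<forall>p d. ((G p) has_real_derivative G' p d) (at d))"
  using assms
proof induction
  case (monomial \<Theta> a)
  have r1: "fps_conv_radius (fps_deriv \<Theta>) = \<infinity>" "fps_conv_radius (fps_deriv psi_fps) = \<infinity>"
    using fps_conv_radius_deriv[of \<Theta>] fps_conv_radius_deriv[of psi_fps] monomial by auto
  have r2: "fps_conv_radius (- (\<Theta> * fps_deriv psi_fps)) = \<infinity>"
    using fps_conv_radius_mult[of \<Theta> "fps_deriv psi_fps"] monomial r1 by auto
  define G' where "G' p d = p ^ (2 * Suc a) * eval_fps (fps_deriv \<Theta>) (p\<^sup>2 * d) * exp (- p\<^sup>2 * psi (p\<^sup>2 * d))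
     + p ^ (2 * (a + 2)) * eval_fps (- (\<Theta> * fps_deriv psi_fps)) (p\<^sup>2 * d) * exp (- p\<^sup>2 * psi (p\<^sup>2 * d))" for p d
  have "gaussian_symbol G'" unfolding G'_def by (intro gaussian_symbol.intros r1 r2)
  moreover have "((\<lambda>d. p ^ (2 * a) * eval_fps \<Theta> (p\<^sup>2 * d) * exp (- p\<^sup>2 * psi (p\<^sup>2 * d))) has_real_derivative G' p d) (at d)"
    for p d
  proof -
    have m: "eval_fps (- (\<Theta> * fps_deriv psi_fps)) z = - (eval_fps \<Theta> z * eval_fps (fps_deriv psi_fps) z)" for z
      using r1 monomial r2 by (subst eval_fps_minus) (auto simp: eval_fps_mult)
    have ch: "((\<lambda>d. eval_fps f (p\<^sup>2 * d)) has_real_derivative eval_fps (fps_deriv f) (p\<^sup>2 * d) * p\<^sup>2) (at d)"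
      if "fps_conv_radius f = \<infinity>" for f
      using that by (intro DERIV_chain2[OF has_field_derivative_eval_fps]) (auto intro!: derivative_eq_intros)
    show ?thesis
      unfolding G'_def m
      by (rule derivative_eq_intros ch monomial fps_conv_radius_psi refl)+
        (simp add: power_add power2_eq_square algebra_simps)
  qed
  ultimately show ?case by blast
next
  case (add F G)
  then obtain F' G' where "gaussian_symbol F'" "gaussian_symbol G'" "\<forall>p d. ((F p) has_real_derivative F' p d) (at d)"
    "\<forall>p d. ((G p) has_real_derivative G' p d) (at d)" by blast
  then show ?case
    by (intro exI[of _ "\<lambda>p d. F' p d + G' p d"]) (auto intro!: gaussian_symbol.intros derivative_eq_intros)
qed

text \<open>As \<open>psi 0 = 1\<close>, the exponential becomes Gaussian in the limit \<open>d = 0\<close> and each \<open>\<Theta>\<close>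
becomes a constant.\<close>

lemma gaussian_symbol_at_0:
  assumes "gaussian_symbol G"
  shows "\<exists>c D. \<forall>p. G p 0 = (\<Sum>a\<le>(D::nat). c a * p ^ (2 * a)) * exp (- p\<^sup>2)"
  using assms
proof induction
  case (monomial \<Theta> a)
  show ?case
    by (rule exI[of _ "\<lambda>i. if i = a then fps_nth \<Theta> 0 else 0"], rule exI[of _ a])
      (auto simp: eval_fps_at_0[of \<Theta>] if_distrib[of "\<lambda>c. c * _"] cong: if_cong)
next
  case (add F G)
  then obtain c D c' D' where c: "\<And>p. F p 0 = (\<Sum>a\<le>(D::nat). c a * p ^ (2 * a)) * exp (- p\<^sup>2)"
    "\<And>p. G p 0 = (\<Sum>a\<le>(D'::nat). c' a * p ^ (2 * a)) * exp (- p\<^sup>2)" by blast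
  have ext: "(\<Sum>a\<le>E. (if a \<le> n then f a else 0)) = (\<Sum>a\<le>n. f a)" if "n \<le> E" for f :: "nat \<Rightarrow> real" and n E :: nat
    using that by (intro sum.mono_neutral_cong_right) auto
  show ?case
  proof (intro exI allI)
    fix p
    show "F p 0 + G p 0 = (\<Sum>a\<le>max D D'. ((if a \<le> D then c a else 0) + (if a \<le> D' then c' a else 0)) * p ^ (2 * a)) * exp (- p\<^sup>2)"
      using ext[of D "max D D'" "\<lambda>a. c a * p ^ (2 * a)"] ext[of D' "max D D'" "\<lambda>a. c' a * p ^ (2 * a)"]
      by (simp add: c ring_distribs sum.distrib if_distrib[of "\<lambda>c. c * _"] cong: if_cong)
  qed
qed

lemma power_times_exp_le:
  fixes b s :: real
  assumes "b > 0" "s \<ge> 0"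
  shows "s ^ n * exp (- b * s) \<le> fact n / b ^ n"
proof -
  have "(\<Sum>i\<in>{n}. inverse (fact i) * (b * s) ^ i) \<le> (\<Sum>i. inverse (fact i) * (b * s) ^ i)"
    using assms by (intro sum_le_suminf summable_exp) auto
  then have "(b * s) ^ n / fact n \<le> exp (b * s)"
    by (simp add: exp_def divide_inverse mult.commute)
  then show ?thesis using assms by (simp add: exp_minus field_simps power_mult_distrib)
qed


text \<open>Half of the decay of \<open>exp (- 2 * b * p\<^sup>2)\<close> is spent on absorbing powers of \<open>p\<close>. The condition
\<open>p\<^sup>2 * d \<le> pi\<^sup>2\<close> describes the rescaled Brillouin zone.\<close>

lemma gaussian_symbol_decay:
  assumes b: "b > 0" "\<forall>s. 0 \<le> s \<and> s \<le> pi\<^sup>2 \<longrightarrow> 2 * b \<le> psi s" and G: "gaussian_symbol G"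
  shows "\<exists>C. \<forall>p d. 0 \<le> d \<and> p\<^sup>2 * d \<le> pi\<^sup>2 \<longrightarrow> p ^ (2 * k) * \<bar>G p d\<bar> \<le> C * exp (- b * p\<^sup>2)"
  using G
proof (induction)
  case (monomial \<Theta> a)
  have "continuous_on {0..pi\<^sup>2} (eval_fps \<Theta>)" using monomial by (intro continuous_intros) auto
  then obtain M where M: "\<forall>s\<in>{0..pi\<^sup>2}. \<bar>eval_fps \<Theta> s\<bar> \<le> M"
    using compact_continuous_image[of "{0..pi\<^sup>2}" "eval_fps \<Theta>"] compact_imp_bounded bounded_real
    by (metis compact_Icc imageI)
  show ?case
  proof (intro exI[of _ "fact (k + a) / b ^ (k + a) * M"] allI impI)
    fix p d :: real assume d: "0 \<le> d \<and> p\<^sup>2 * d \<le> pi\<^sup>2"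
    have e: "exp (- p\<^sup>2 * psi (p\<^sup>2 * d)) \<le> exp (- b * p\<^sup>2) * exp (- b * p\<^sup>2)"
    proof -
      have "p\<^sup>2 * (2 * b) \<le> p\<^sup>2 * psi (p\<^sup>2 * d)" using b(2) d by (intro mult_left_mono) auto
      then have "- p\<^sup>2 * psi (p\<^sup>2 * d) \<le> - b * p\<^sup>2 + - b * p\<^sup>2" by (simp add: algebra_simps)
      then show ?thesis by (simp only: exp_le_cancel_iff flip: exp_add)
    qed
    have M': "\<bar>eval_fps \<Theta> (p\<^sup>2 * d)\<bar> \<le> M" "0 \<le> M" using M d by force+
    have "p ^ (2 * k) * \<bar>p ^ (2 * a) * eval_fps \<Theta> (p\<^sup>2 * d) * exp (- p\<^sup>2 * psi (p\<^sup>2 * d))\<bar>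
       = (p\<^sup>2) ^ (k + a) * (\<bar>eval_fps \<Theta> (p\<^sup>2 * d)\<bar> * exp (- p\<^sup>2 * psi (p\<^sup>2 * d)))"
      by (simp add: abs_mult power_add power_mult)
    also have "\<dots> \<le> (p\<^sup>2) ^ (k + a) * (M * (exp (- b * p\<^sup>2) * exp (- b * p\<^sup>2)))"
      using M' e by (intro mult_left_mono mult_mono) auto
    also have "\<dots> = ((p\<^sup>2) ^ (k + a) * exp (- b * p\<^sup>2)) * (M * exp (- b * p\<^sup>2))" by simp
    also have "\<dots> \<le> (fact (k + a) / b ^ (k + a)) * (M * exp (- b * p\<^sup>2))"
      using M' by (intro mult_right_mono power_times_exp_le b) auto
    finally show "p ^ (2 * k) * \<bar>p ^ (2 * a) * eval_fps \<Theta> (p\<^sup>2 * d) * exp (- p\<^sup>2 * psi (p\<^sup>2 * d))\<bar>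
       \<le> fact (k + a) / b ^ (k + a) * M * exp (- b * p\<^sup>2)" by simp
  qed
next
  case (add F G)
  then obtain C C' where
    "\<forall>p d. 0 \<le> d \<and> p\<^sup>2 * d \<le> pi\<^sup>2 \<longrightarrow> p ^ (2 * k) * \<bar>F p d\<bar> \<le> C * exp (- b * p\<^sup>2)"
    "\<forall>p d. 0 \<le> d \<and> p\<^sup>2 * d \<le> pi\<^sup>2 \<longrightarrow> p ^ (2 * k) * \<bar>G p d\<bar> \<le> C' * exp (- b * p\<^sup>2)"
    by blast
  then have "p ^ (2 * k) * \<bar>F p d + G p d\<bar> \<le> (C + C') * exp (- b * p\<^sup>2)"
    if "0 \<le> d" "p\<^sup>2 * d \<le> pi\<^sup>2" for p d
  proof -
    have "p ^ (2 * k) * \<bar>F p d + G p d\<bar> \<le> p ^ (2 * k) * (\<bar>F p d\<bar> + \<bar>G p d\<bar>)"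
      by (intro mult_left_mono) auto
    also have "\<dots> \<le> (C + C') * exp (- b * p\<^sup>2)"
      using that \<open>\<forall>p d. _ \<longrightarrow> p ^ (2 * k) * \<bar>F p d\<bar> \<le> _\<close>[rule_format, of d p]
        \<open>\<forall>p d. _ \<longrightarrow> p ^ (2 * k) * \<bar>G p d\<bar> \<le> _\<close>[rule_format, of d p]
      by (simp add: algebra_simps)
    finally show ?thesis .
  qed
  then show ?case by blast
qed

text \<open>The factor \<open>\<tau> ^ j\<close> times the integrand of the \<open>j\<close>-th time derivative of the kernel, without the
cosine, in the variables \<open>p = sqrt \<tau> * \<xi>\<close> and \<open>d = 1 / \<tau>\<close>.\<close>

definition rescaled_symbol :: "nat \<Rightarrow> real \<Rightarrow> real \<Rightarrow> real" where
  "rescaled_symbol j p d = (- p\<^sup>2 * psi (p\<^sup>2 * d)) ^ j * exp (- p\<^sup>2 * psi (p\<^sup>2 * d))"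

lemma gaussian_symbol_rescaled_symbol: "gaussian_symbol (rescaled_symbol j)"
proof -
  have r: "fps_conv_radius ((- psi_fps) ^ j) = \<infinity>"
    using fps_conv_radius_power[of "- psi_fps" j] by simp
  have "rescaled_symbol j = (\<lambda>p d. p ^ (2 * j) * eval_fps ((- psi_fps) ^ j) (p\<^sup>2 * d) * exp (- p\<^sup>2 * psi (p\<^sup>2 * d)))"
    by (intro ext) (simp add: rescaled_symbol_def eval_fps_power eval_fps_minus power_mult flip: power_mult_distrib)
  then show ?thesis using monomial[OF r, of j] by simp
qed

text \<open>Inside the rescaled Brillouin zone this is Taylor's formula in \<open>d\<close> with Lagrange remainder,
which is Gaussian by \<open>gaussian_symbol_decay\<close>. Outside it the indicator removes the symbol, and the Taylor
polynomial itself is small: there \<open>1 \<le> p\<^sup>2 * d\<close>, so missing powers of \<open>d\<close> can be traded for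
powers of \<open>p\<close>. The coefficients \<open>c m 0\<close> vanish for \<open>m \<ge> 1\<close> because at \<open>p = 0\<close> the rescaled
symbol does not depend on \<open>d\<close>; this is why the undifferentiated profile does not occur in the
higher terms of the expansion.\<close>

lemma rescaled_symbol_expansion:
  assumes b: "b > 0" "\<forall>s. 0 \<le> s \<and> s \<le> pi\<^sup>2 \<longrightarrow> 2 * b \<le> psi s"
  shows "\<exists>c D. c 0 = (\<lambda>a. if a = j then (-1) ^ j else 0) \<and> D 0 = j \<and> (\<forall>m\<ge>1. c m 0 = 0) \<and>
    (\<forall>N. \<exists>C. \<forall>p. \<forall>d>0. \<bar>indicator {p. p\<^sup>2 * d \<le> pi\<^sup>2} p * rescaled_symbol j p d
        - (\<Sum>m<N. d ^ m * ((\<Sum>a\<le>(D m::nat). c m a * p ^ (2 * a)) * exp (- p\<^sup>2)))\<bar> \<le> C * d ^ N * exp (- b * p\<^sup>2))"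
proof -
  have "\<exists>G. G 0 = rescaled_symbol j \<and> (\<forall>n. gaussian_symbol (G n) \<and> (\<forall>p d. ((G n p) has_real_derivative G (Suc n) p d) (at d)))"
  proof -
    have "\<exists>G. \<forall>n. (gaussian_symbol (G n) \<and> (n = 0 \<longrightarrow> G n = rescaled_symbol j)) \<and> (\<forall>p d. ((G n p) has_real_derivative G (Suc n) p d) (at d))"
    proof (rule dependent_nat_choice)
      show "\<exists>y. gaussian_symbol y \<and> (0 = 0 \<longrightarrow> y = rescaled_symbol j)" using gaussian_symbol_rescaled_symbol by blast
    next
      fix x and n :: nat assume "gaussian_symbol x \<and> (n = 0 \<longrightarrow> x = rescaled_symbol j)"
      then show "\<exists>y. (gaussian_symbol y \<and> (Suc n = 0 \<longrightarrow> y = rescaled_symbol j)) \<and> (\<forall>p d. (x p has_real_derivative y p d) (at d))"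
        using gaussian_symbol_derivative[of x] by auto
    qed
    then show ?thesis by metis
  qed
  then obtain G where G0: "G 0 = rescaled_symbol j" and sG: "\<And>n. gaussian_symbol (G n)"
    and dG: "\<And>n p d. ((G n p) has_real_derivative G (Suc n) p d) (at d)" by metis
  have G00: "G (Suc m) 0 0 = 0" for m
  proof -
    have "G m 0 = (\<lambda>d. G m 0 0)" for m
    proof (induction m)
      case 0 show ?case by (simp add: G0 rescaled_symbol_def)
    next
      case (Suc m)
      show ?case
      proof
        fix d
        have "G (Suc m) 0 e = 0" for e
          using dG[of m 0 e] by (subst (asm) Suc) (metis DERIV_const DERIV_unique)
        then show "G (Suc m) 0 d = G (Suc m) 0 0" by simp
      qed
    qed
    then show ?thesis using dG[of m 0 0] by (metis DERIV_const DERIV_unique)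
  qed
  define P where "P m c D \<longleftrightarrow> (\<forall>p. G m p 0 / fact m = (\<Sum>a\<le>D. c a * p ^ (2 * a)) * exp (- p\<^sup>2)) \<and>
     (m = 0 \<longrightarrow> c = (\<lambda>a. if a = j then (-1) ^ j else 0) \<and> D = j) \<and> (m \<ge> 1 \<longrightarrow> c 0 = 0)"
    for m D :: nat and c :: "nat \<Rightarrow> real"
  have "\<forall>m. \<exists>c D. P m c D"
  proof
    fix m
    show "\<exists>c D. P m c D"
    proof (cases m)
      case 0
      have "G 0 p 0 = (\<Sum>a\<le>j. (if a = j then (-1) ^ j else 0) * p ^ (2 * a)) * exp (- p\<^sup>2)" for p
        by (simp add: G0 rescaled_symbol_def power_mult flip: power_mult_distrib
            add: if_distrib[of "\<lambda>c. c * _"] cong: if_cong)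
      then show ?thesis
        by (intro exI[of _ "\<lambda>a. if a = j then (-1) ^ j else 0"] exI[of _ j]) (auto simp: 0 P_def)
    next
      case (Suc n)
      obtain c D where c: "\<And>p. G m p 0 = (\<Sum>a\<le>(D::nat). c a * p ^ (2 * a)) * exp (- p\<^sup>2)"
        using gaussian_symbol_at_0[OF sG[of m]] by blast
      have "c 0 = 0" using c[of 0] G00[of n] Suc by (simp add: power_0_left sum.atMost_shift)
      have "G m p 0 / fact m = (\<Sum>a\<le>D. c a / fact m * p ^ (2 * a)) * exp (- p\<^sup>2)" for p :: real
      proof -
        have "(\<Sum>a\<le>D. c a / fact m * p ^ (2 * a)) = (\<Sum>a\<le>D. c a * p ^ (2 * a)) / fact m"
          by (simp add: sum_divide_distrib)
        then show ?thesis by (simp add: c[of p])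
      qed
      moreover have "c 0 / fact m = 0" using \<open>c 0 = 0\<close> by simp
      ultimately show ?thesis
        unfolding P_def
        by (intro exI[of _ "\<lambda>a. c a / fact m"] exI[of _ D] conjI allI impI) (auto simp only: Suc)
    qed
  qed
  then obtain c D where "\<And>m. P m (c m) (D m)" by metis
  then have cD: "\<And>m p. G m p 0 / fact m = (\<Sum>a\<le>(D m::nat). c m a * p ^ (2 * a)) * exp (- p\<^sup>2)"
     "c 0 = (\<lambda>a. if a = j then (-1) ^ j else 0)" "D 0 = j" "\<And>m. m \<ge> 1 \<Longrightarrow> c m 0 = 0"
    unfolding P_def by blast+
  have "\<exists>C. \<forall>p. \<forall>d>0. \<bar>indicator {p. p\<^sup>2 * d \<le> pi\<^sup>2} p * rescaled_symbol j p d
        - (\<Sum>m<N. d ^ m * ((\<Sum>a\<le>(D m::nat). c m a * p ^ (2 * a)) * exp (- p\<^sup>2)))\<bar> \<le> C * d ^ N * exp (- b * p\<^sup>2)" for N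
  proof -
    have "\<forall>k n. \<exists>C. \<forall>p d. 0 \<le> d \<and> p\<^sup>2 * d \<le> pi\<^sup>2 \<longrightarrow> p ^ (2 * k) * \<bar>G n p d\<bar> \<le> C * exp (- b * p\<^sup>2)"
      using gaussian_symbol_decay[OF b sG] by blast
    then obtain C where C: "\<And>k n p d. 0 \<le> d \<Longrightarrow> p\<^sup>2 * d \<le> pi\<^sup>2 \<Longrightarrow> p ^ (2 * k) * \<bar>G n p d\<bar> \<le> C k n * exp (- b * p\<^sup>2)"
      by metis
    have C0: "0 \<le> C k n" for k n
    proof -
      have "0 \<le> 0 ^ (2 * k) * \<bar>G n 0 0\<bar>" by simp
      also have "\<dots> \<le> C k n * exp (- b * 0\<^sup>2)" by (rule C) auto
      finally show ?thesis by simp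
    qed
    have inner: "\<bar>rescaled_symbol j p d - (\<Sum>m<N. d ^ m * (G m p 0 / fact m))\<bar> \<le> C 0 N * d ^ N * exp (- b * p\<^sup>2)"
      if d: "d > 0" "p\<^sup>2 * d \<le> pi\<^sup>2" for p d
    proof -
      have "\<exists>t. 0 \<le> t \<and> t \<le> d \<and> rescaled_symbol j p d - (\<Sum>m<N. d ^ m * (G m p 0 / fact m)) = G N p t / fact N * d ^ N"
      proof (cases "N = 0")
        case True
        then show ?thesis using d by (intro exI[of _ d]) (auto simp: G0)
      next
        case False
        have "\<exists>t. 0 < t \<and> t < d \<and>
          rescaled_symbol j p d = (\<Sum>m<N. G m p 0 / fact m * d ^ m) + G N p t / fact N * d ^ N"
        proof (rule Maclaurin[where diff = "\<lambda>n. G n p"])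
          show "G 0 p = rescaled_symbol j p" by (simp only: G0)
          show "\<forall>m t. m < N \<and> 0 \<le> t \<and> t \<le> d \<longrightarrow> (G m p has_real_derivative G (Suc m) p t) (at t)"
            using dG by blast
        qed (use d False in auto)
        then obtain t where "0 < t" "t < d"
          "rescaled_symbol j p d = (\<Sum>m<N. G m p 0 / fact m * d ^ m) + G N p t / fact N * d ^ N"
          by blast
        then show ?thesis by (intro exI[of _ t]) (simp add: mult.commute)
      qed
      then obtain t where t: "0 \<le> t" "t \<le> d" "rescaled_symbol j p d - (\<Sum>m<N. d ^ m * (G m p 0 / fact m)) = G N p t / fact N * d ^ N"
        by blast
      have "p\<^sup>2 * t \<le> p\<^sup>2 * d" using t by (intro mult_left_mono) auto
      then have "\<bar>G N p t\<bar> \<le> C 0 N * exp (- b * p\<^sup>2)" using C[of t p 0 N] t d by simp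
      moreover have "\<bar>G N p t\<bar> / fact N \<le> \<bar>G N p t\<bar> / 1"
        by (intro divide_left_mono) auto
      ultimately have "\<bar>G N p t\<bar> / fact N \<le> C 0 N * exp (- b * p\<^sup>2)" by simp
      then have "\<bar>G N p t\<bar> / fact N * d ^ N \<le> C 0 N * exp (- b * p\<^sup>2) * d ^ N"
        using d by (intro mult_right_mono) auto
      then show ?thesis using t d by (simp add: abs_mult mult_ac)
    qed
    have outer: "\<bar>\<Sum>m<N. d ^ m * (G m p 0 / fact m)\<bar> \<le> (\<Sum>m<N. C (N - m) m) * d ^ N * exp (- b * p\<^sup>2)"
      if d: "d > 0" "\<not> p\<^sup>2 * d \<le> pi\<^sup>2" for p d
    proof -
      have one: "1 \<le> p\<^sup>2 * d"
      proof -
        have "1 \<le> pi\<^sup>2" using pi_ge_two by (intro one_le_power) linarith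
        then show ?thesis using d by linarith
      qed
      have "\<bar>d ^ m * (G m p 0 / fact m)\<bar> \<le> C (N - m) m * d ^ N * exp (- b * p\<^sup>2)" if m: "m < N" for m
      proof -
        have "1 \<le> (p\<^sup>2 * d) ^ (N - m)" using one by (rule one_le_power)
        then have "d ^ m * \<bar>G m p 0\<bar> * 1 \<le> d ^ m * \<bar>G m p 0\<bar> * (p\<^sup>2 * d) ^ (N - m)"
          using d by (intro mult_left_mono) auto
        also have "\<dots> = (d ^ m * d ^ (N - m)) * (p ^ (2 * (N - m)) * \<bar>G m p 0\<bar>)"
          unfolding power_mult[of p 2 "N - m"] by (simp add: power_mult_distrib mult_ac)
        also have "\<dots> \<le> (d ^ m * d ^ (N - m)) * (C (N - m) m * exp (- b * p\<^sup>2))"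
          using d by (intro mult_left_mono C) auto
        also have "d ^ m * d ^ (N - m) = d ^ N" using m by (simp flip: power_add)
        finally have *: "d ^ m * \<bar>G m p 0\<bar> \<le> d ^ N * (C (N - m) m * exp (- b * p\<^sup>2))" by simp
        have "\<bar>d ^ m * (G m p 0 / fact m)\<bar> = d ^ m * \<bar>G m p 0\<bar> / fact m" using d by (simp add: abs_mult)
        also have "\<dots> \<le> d ^ m * \<bar>G m p 0\<bar> / 1" using d by (intro divide_left_mono) auto
        finally show ?thesis using * by (simp add: mult_ac)
      qed
      then have "(\<Sum>m<N. \<bar>d ^ m * (G m p 0 / fact m)\<bar>) \<le> (\<Sum>m<N. C (N - m) m * d ^ N * exp (- b * p\<^sup>2))"
        by (intro sum_mono) auto
      then show ?thesis using sum_abs[of "\<lambda>m. d ^ m * (G m p 0 / fact m)" "{..<N}"]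
        by (simp add: sum_distrib_right)
    qed
    show ?thesis
    proof (intro exI allI impI)
      fix p d :: real assume d: "d > 0"
      define S where "S = (\<Sum>m<N. C (N - m) m)"
      have S: "0 \<le> S" unfolding S_def by (intro sum_nonneg C0)
      have nn: "0 \<le> C 0 N * d ^ N * exp (- b * p\<^sup>2)" "0 \<le> S * d ^ N * exp (- b * p\<^sup>2)"
        using d S C0 by auto
      show "\<bar>indicator {p. p\<^sup>2 * d \<le> pi\<^sup>2} p * rescaled_symbol j p d
        - (\<Sum>m<N. d ^ m * ((\<Sum>a\<le>(D m::nat). c m a * p ^ (2 * a)) * exp (- p\<^sup>2)))\<bar>
        \<le> (C 0 N + (\<Sum>m<N. C (N - m) m)) * d ^ N * exp (- b * p\<^sup>2)"
        unfolding cD(1)[symmetric] S_def[symmetric]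
        using inner[OF d, of p] outer[OF d, of p] nn
        by (cases "p\<^sup>2 * d \<le> pi\<^sup>2") (simp_all add: ring_distribs S_def[symmetric])
    qed
  qed
  then show ?thesis using cD by blast
qed

section \<open>Derivatives of the one-dimensional Gaussian\<close>

text \<open>The \<open>n\<close>-th derivative of \<open>exp (- y\<^sup>2 / 4) / (2 * sqrt pi)\<close>, written as a Fourier integral: each
derivative multiplies the integrand by \<open>p\<close> and advances the phase of the cosine by \<open>pi / 2\<close>.\<close>

definition gauss_deriv :: "nat \<Rightarrow> real \<Rightarrow> real" where
  "gauss_deriv n y = 1 / (2 * pi) * (\<integral>p. p ^ n * exp (- p\<^sup>2) * cos (y * p + real n * (pi / 2)) \<partial>lborel)"

lemma integrable_power_times_gaussian:
  "integrable lborel (\<lambda>p::real. p ^ n * exp (- p\<^sup>2))"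
proof -
  have "integrable lborel (\<lambda>p::real. exp (- p\<^sup>2) * p ^ n)"
  proof (cases "even n")
    case True
    then obtain k where n: "n = 2 * k" by blast
    show ?thesis unfolding n
      by (rule has_bochner_integral_even_function[OF gaussian_moment_even_pos, THEN integrable.intros])
        simp
  next
    case False
    then obtain k where n: "n = 2 * k + 1" using oddE by blast
    show ?thesis unfolding n
      by (rule has_bochner_integral_odd_function[OF gaussian_moment_odd_pos, THEN integrable.intros])
        simp
  qed
  then show ?thesis by (simp add: mult.commute)
qed

lemma integrable_gaussian:
  assumes "b > 0"
  shows "integrable lborel (\<lambda>p::real. exp (- b * p\<^sup>2))"
  using lborel_integrable_real_affine[OF integrable_power_times_gaussian[of 0], of "sqrt b" 0] assms
  by (simp add: power_mult_distrib)

lemma integrable_power_gaussian_cos: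
  "integrable lborel (\<lambda>p::real. p ^ n * exp (- p\<^sup>2) * cos (y * p + c))"
proof (rule Bochner_Integration.integrable_bound[OF integrable_power_times_gaussian[of n]])
  show "AE p in lborel. norm (p ^ n * exp (- p\<^sup>2) * cos (y * p + c)) \<le> norm (p ^ n * exp (- p\<^sup>2))"
    by (intro AE_I2) (simp add: abs_mult mult_left_le)
qed simp

lemma gauss_deriv_bounded: "\<exists>M. \<forall>y. \<bar>gauss_deriv n y\<bar> \<le> M"
proof (intro exI allI)
  fix y
  have "\<bar>\<integral>p. p ^ n * exp (- p\<^sup>2) * cos (y * p + real n * (pi / 2)) \<partial>lborel\<bar> \<le> (\<integral>p. \<bar>p ^ n * exp (- p\<^sup>2)\<bar> \<partial>lborel)"
    using Bochner_Integration.integral_norm_bound_integral[OF integrable_power_gaussian_cos integrable_abs[OF integrable_power_times_gaussian]]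
    by (simp add: abs_mult mult_left_le)
  then show "\<bar>gauss_deriv n y\<bar> \<le> 1 / (2 * pi) * (\<integral>p. \<bar>p ^ n * exp (- p\<^sup>2)\<bar> \<partial>lborel)"
    by (simp add: gauss_deriv_def abs_mult divide_right_mono)
qed

text \<open>A second-order bound that is uniform in the phase. It replaces dominated convergence when the
Fourier integral is differentiated, since it bounds the error of the linear approximation
by a Gaussian moment of order \<open>n + 2\<close>.\<close>

lemma cos_shift_Taylor:
  "\<bar>cos (x + h + real n * (pi / 2)) - cos (x + real n * (pi / 2)) - h * cos (x + real (Suc n) * (pi / 2))\<bar> \<le> h\<^sup>2"
proof -
  have "norm (cos (x + h + real (n + 0) * (pi / 2)) - (\<Sum>i\<le>1. cos (x + real (n + i) * (pi / 2)) * (x + h - x) ^ i / fact i))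
     \<le> 1 * norm (x + h - x) ^ Suc 1 / fact 1"
  proof (rule field_Taylor[where S = UNIV and f = "\<lambda>i x. cos (x + real (n + i) * (pi / 2))"])
    show "((\<lambda>x. cos (x + real (n + i) * (pi / 2))) has_field_derivative cos (x + real (n + Suc i) * (pi / 2))) (at x within UNIV)"
      for i and x :: real
    proof -
      have "cos (x + real (n + Suc i) * (pi / 2)) = - sin (x + real (n + i) * (pi / 2))"
        by (simp add: ring_distribs add.assoc[symmetric] cos_add[of _ "pi / 2"] add_divide_distrib)
          (metis add.commute add.left_commute cos_add cos_pi_half sin_pi_half mult_zero_right mult.right_neutral diff_0)
      then show ?thesis by (auto intro!: derivative_eq_intros)
    qed
  qed auto
  then show ?thesis by (simp add: power2_eq_square algebra_simps)
qed

lemma gauss_deriv_has_derivative: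
  "(gauss_deriv n has_real_derivative gauss_deriv (Suc n) y) (at y)"
proof -
  define I where "I n y = (\<integral>p. p ^ n * exp (- p\<^sup>2) * cos (y * p + real n * (pi / 2)) \<partial>lborel)" for n y
  define K where "K = (\<integral>p. \<bar>(p::real) ^ (n + 2) * exp (- p\<^sup>2)\<bar> \<partial>lborel)"
  have bound: "\<bar>I n (y + h) - I n y - h * I (Suc n) y\<bar> \<le> h\<^sup>2 * K" for h
  proof -
    note i = integrable_power_gaussian_cos
    have eq: "I n (y + h) - I n y - h * I (Suc n) y =
      (\<integral>p. p ^ n * exp (- p\<^sup>2) * cos ((y + h) * p + real n * (pi / 2)) - p ^ n * exp (- p\<^sup>2) * cos (y * p + real n * (pi / 2))
         - h * (p ^ Suc n * exp (- p\<^sup>2) * cos (y * p + real (Suc n) * (pi / 2))) \<partial>lborel)"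
      unfolding I_def
      by (simp only: Bochner_Integration.integral_diff Bochner_Integration.integrable_diff
          integral_mult_right_zero integrable_mult_right i)
    show ?thesis
      unfolding eq K_def integral_mult_right_zero[symmetric]
    proof (rule Bochner_Integration.integral_abs_bound_integral)
      fix p :: real
      have "p ^ n * exp (- p\<^sup>2) * cos ((y + h) * p + real n * (pi / 2)) - p ^ n * exp (- p\<^sup>2) * cos (y * p + real n * (pi / 2))
         - h * (p ^ Suc n * exp (- p\<^sup>2) * cos (y * p + real (Suc n) * (pi / 2))) =
         p ^ n * exp (- p\<^sup>2) * (cos (y * p + h * p + real n * (pi / 2)) - cos (y * p + real n * (pi / 2))
           - (h * p) * cos (y * p + real (Suc n) * (pi / 2)))" (is "?l = ?e * ?r")
        unfolding right_diff_distrib distrib_right[of y h p] power_Suc by (simp only: mult_ac)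
      then have "\<bar>?l\<bar> = \<bar>?e\<bar> * \<bar>?r\<bar>"
        by (simp only: abs_mult)
      also have "\<dots> \<le> \<bar>p ^ n * exp (- p\<^sup>2)\<bar> * (h * p)\<^sup>2"
        by (intro mult_left_mono cos_shift_Taylor) auto
      also have "\<dots> = h\<^sup>2 * \<bar>p ^ (n + 2) * exp (- p\<^sup>2)\<bar>"
        by (simp only: abs_mult power_add power_mult_distrib abs_power2 mult_ac)
      finally show "\<bar>p ^ n * exp (- p\<^sup>2) * cos ((y + h) * p + real n * (pi / 2)) - p ^ n * exp (- p\<^sup>2) * cos (y * p + real n * (pi / 2))
         - h * (p ^ Suc n * exp (- p\<^sup>2) * cos (y * p + real (Suc n) * (pi / 2)))\<bar> \<le> h\<^sup>2 * \<bar>p ^ (n + 2) * exp (- p\<^sup>2)\<bar>" .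
    next
      show "integrable lborel (\<lambda>p::real. h\<^sup>2 * \<bar>p ^ (n + 2) * exp (- p\<^sup>2)\<bar>)"
        by (rule integrable_mult_right, rule integrable_abs, rule integrable_power_times_gaussian)
    qed (rule Bochner_Integration.integrable_diff, rule Bochner_Integration.integrable_diff, rule i, rule i, rule integrable_mult_right, rule i)
  qed
  have "(I n has_real_derivative I (Suc n) y) (at y)"
    unfolding DERIV_def
  proof (rule LIM_zero_cancel, rule Lim_null_comparison[where g = "\<lambda>h. \<bar>h\<bar> * K"])
    have "norm ((I n (y + h) - I n y) / h - I (Suc n) y) \<le> \<bar>h\<bar> * K" if "h \<noteq> 0" for h
    proof -
      have "norm ((I n (y + h) - I n y) / h - I (Suc n) y) = \<bar>I n (y + h) - I n y - h * I (Suc n) y\<bar> / \<bar>h\<bar>"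
      proof -
        have "(I n (y + h) - I n y) / h - I (Suc n) y = (I n (y + h) - I n y - h * I (Suc n) y) / h"
          using that by (simp add: diff_divide_distrib)
        then show ?thesis by (simp only: real_norm_def abs_divide)
      qed
      also have "\<dots> \<le> h\<^sup>2 * K / \<bar>h\<bar>" by (intro divide_right_mono bound) auto
      also have "\<dots> = \<bar>h\<bar> * K" using that by (simp add: power2_eq_square abs_if)
      finally show ?thesis .
    qed
    then show "\<forall>\<^sub>F h in at 0. norm ((I n (y + h) - I n y) / h - I (Suc n) y) \<le> \<bar>h\<bar> * K"
      by (auto simp: eventually_at_filter)
    show "((\<lambda>h. \<bar>h\<bar> * K) \<longlongrightarrow> 0) (at 0)" by (auto intro!: tendsto_eq_intros)
  qed
  then have "((\<lambda>y. 1 / (2 * pi) * I n y) has_real_derivative 1 / (2 * pi) * I (Suc n) y) (at y)"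
    by (rule DERIV_cmult)
  then show ?thesis by (simp add: gauss_deriv_def[abs_def] I_def[abs_def])
qed

lemma gauss_deriv_even:
  "gauss_deriv (2 * a) y = 1 / (2 * pi) * ((-1) ^ a * (\<integral>p. p ^ (2 * a) * exp (- p\<^sup>2) * cos (y * p) \<partial>lborel))"
proof -
  have "cos (y * p + real (2 * a) * (pi / 2)) = (-1) ^ a * cos (y * p)" for p
    by (simp add: cos_add)
  then show ?thesis unfolding gauss_deriv_def
    by (simp flip: integral_mult_right_zero add: mult_ac)
qed

text \<open>The Gaussian is its own Fourier transform; the value is read off from the characteristic
function of the standard normal distribution after rescaling by \<open>sqrt 2\<close>.\<close>

lemma gauss_deriv_0: "gauss_deriv 0 y = exp (- y\<^sup>2 / 4) / (2 * sqrt pi)"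
proof -
  define t where "t = y / sqrt 2"
  have "complex_of_real (exp (- t\<^sup>2 / 2)) = (CLINT x|std_normal_distribution. iexp (t * x))"
    using char_std_normal_distribution by (simp add: char_def fun_eq_iff)
  then have "exp (- t\<^sup>2 / 2) = Re (CLINT x|std_normal_distribution. iexp (t * x))"
    by (metis Re_complex_of_real)
  also have "\<dots> = (LINT x|std_normal_distribution. Re (iexp (t * x)))"
  proof (rule integral_Re[symmetric])
    interpret real_distribution std_normal_distribution by (rule real_dist_normal_dist)
    show "complex_integrable std_normal_distribution (\<lambda>x. iexp (t * x))"
      by (intro integrable_const_bound[where B = 1]) auto
  qed
  also have "\<dots> = (LINT x|lborel. std_normal_density x * cos (t * x))"
    by (subst integral_density) (auto simp: normal_density_nonneg Re_exp)
  also have "\<dots> = (LINT x|lborel. 1 / sqrt (2 * pi) * (exp (- x\<^sup>2 / 2) * cos (t * x)))"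
    by (simp add: std_normal_density_def mult.assoc)
  also have "\<dots> = 1 / sqrt (2 * pi) * (LINT x|lborel. exp (- x\<^sup>2 / 2) * cos (t * x))"
    by (rule integral_mult_right_zero)
  also have "(LINT x|lborel. exp (- x\<^sup>2 / 2) * cos (t * x)) = sqrt 2 * (LINT p|lborel. exp (- p\<^sup>2) * cos (y * p))"
    by (subst lborel_integral_real_affine[of "sqrt 2" _ 0]) (auto simp: power_mult_distrib t_def)
  finally have eq: "sqrt pi * exp (- y\<^sup>2 / 4) = (LINT p|lborel. exp (- p\<^sup>2) * cos (y * p))"
    by (simp add: t_def power_divide real_sqrt_mult field_simps)
  then show ?thesis unfolding gauss_deriv_def
    using real_sqrt_mult_self[of pi] by (simp flip: eq) (simp add: field_simps)
qed

section \<open>The kernel of the one-dimensional walk\<close>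

text \<open>The \<open>j\<close>-th time derivative of the transition function of the continuous-time walk on the integers
that jumps to each neighbour at rate 1. The position \<open>k\<close> is real, which makes
sense in the Fourier formula and avoids coercions.\<close>

definition walk_kernel :: "nat \<Rightarrow> real \<Rightarrow> real \<Rightarrow> real" where
  "walk_kernel j k \<tau> = 1 / (2 * pi) * integral {-pi..pi}
     (\<lambda>\<xi>. (- (2 * (1 - cos \<xi>))) ^ j * exp (- \<tau> * (2 * (1 - cos \<xi>))) * cos (k * \<xi>))"

lemma walk_kernel_has_derivative:
  "(walk_kernel j k has_real_derivative walk_kernel (Suc j) k \<tau>) (at \<tau>)"
proof -
  have "((\<lambda>\<tau>. integral (cbox (-pi) pi)
     (\<lambda>\<xi>. (- (2 * (1 - cos \<xi>))) ^ j * exp (- \<tau> * (2 * (1 - cos \<xi>))) * cos (k * \<xi>)))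
     has_field_derivative integral (cbox (-pi) pi)
     (\<lambda>\<xi>. (- (2 * (1 - cos \<xi>))) ^ Suc j * exp (- \<tau> * (2 * (1 - cos \<xi>))) * cos (k * \<xi>))) (at \<tau> within UNIV)"
  proof (rule leibniz_rule_field_derivative)
    show "((\<lambda>\<tau>. (- (2 * (1 - cos \<xi>))) ^ j * exp (- \<tau> * (2 * (1 - cos \<xi>))) * cos (k * \<xi>)) has_field_derivative
      (- (2 * (1 - cos \<xi>))) ^ Suc j * exp (- \<tau> * (2 * (1 - cos \<xi>))) * cos (k * \<xi>)) (at \<tau> within UNIV)" for \<tau> \<xi> :: real
      by (rule derivative_eq_intros refl)+ (simp add: algebra_simps)
    show "(\<lambda>\<xi>. (- (2 * (1 - cos \<xi>))) ^ j * exp (- \<tau> * (2 * (1 - cos \<xi>))) * cos (k * \<xi>)) integrable_on cbox (-pi) pi" for \<tau>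
      by (intro integrable_continuous continuous_intros)
    show "continuous_on (UNIV \<times> cbox (-pi) pi) (\<lambda>(\<tau>, \<xi>). (- (2 * (1 - cos \<xi>))) ^ Suc j * exp (- \<tau> * (2 * (1 - cos \<xi>))) * cos (k * \<xi>))"
      unfolding split_beta by (intro continuous_intros)
  qed auto
  from DERIV_cmult[OF this, of "1 / (2 * pi)"] show ?thesis
    by (simp only: walk_kernel_def[abs_def] cbox_interval)
qed

lemma walk_kernel_heat_equation:
  "walk_kernel (Suc 0) k \<tau> = walk_kernel 0 (k + 1) \<tau> + walk_kernel 0 (k - 1) \<tau> - 2 * walk_kernel 0 k \<tau>"
proof -
  let ?e = "\<lambda>\<xi>. exp (- \<tau> * (2 * (1 - cos \<xi>)))"
  have i: "(\<lambda>\<xi>. ?e \<xi> * cos (l * \<xi>)) integrable_on {-pi..pi}" for l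
    by (intro integrable_continuous_interval continuous_intros)
  have "integral {-pi..pi} (\<lambda>\<xi>. ?e \<xi> * cos ((k + 1) * \<xi>) + ?e \<xi> * cos ((k - 1) * \<xi>) - 2 * (?e \<xi> * cos (k * \<xi>)))
    = integral {-pi..pi} (\<lambda>\<xi>. ?e \<xi> * cos ((k + 1) * \<xi>)) + integral {-pi..pi} (\<lambda>\<xi>. ?e \<xi> * cos ((k - 1) * \<xi>))
      - 2 * integral {-pi..pi} (\<lambda>\<xi>. ?e \<xi> * cos (k * \<xi>))"
    by (intro integral_unique has_integral_diff has_integral_add has_integral_mult_right integrable_integral i)
  moreover have "?e \<xi> * cos ((k + 1) * \<xi>) + ?e \<xi> * cos ((k - 1) * \<xi>) - 2 * (?e \<xi> * cos (k * \<xi>))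
    = - (2 * (1 - cos \<xi>)) * ?e \<xi> * cos (k * \<xi>)" for \<xi>
  proof -
    have "cos ((k + 1) * \<xi>) + cos ((k - 1) * \<xi>) = 2 * cos \<xi> * cos (k * \<xi>)"
      by (simp add: distrib_right left_diff_distrib cos_add cos_diff)
    then have "?e \<xi> * (cos ((k + 1) * \<xi>) + cos ((k - 1) * \<xi>)) = ?e \<xi> * (2 * cos \<xi> * cos (k * \<xi>))" by simp
    then show ?thesis by (simp add: algebra_simps)
  qed
  ultimately have "integral {-pi..pi} (\<lambda>\<xi>. - (2 * (1 - cos \<xi>)) * ?e \<xi> * cos (k * \<xi>))
    = integral {-pi..pi} (\<lambda>\<xi>. ?e \<xi> * cos ((k + 1) * \<xi>)) + integral {-pi..pi} (\<lambda>\<xi>. ?e \<xi> * cos ((k - 1) * \<xi>))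
      - 2 * integral {-pi..pi} (\<lambda>\<xi>. ?e \<xi> * cos (k * \<xi>))"
    by (simp only:)
  then show ?thesis
    unfolding walk_kernel_def power_Suc power_0 mult_1_right mult_1_left
    by (simp only: right_diff_distrib distrib_left mult.left_commute[of 2])
qed

lemma walk_kernel_bounded:
  assumes "\<tau> \<ge> 0" shows "\<bar>walk_kernel 0 k \<tau>\<bar> \<le> 1"
proof -
  have "norm (integral {-pi..pi} (\<lambda>\<xi>. exp (- \<tau> * (2 * (1 - cos \<xi>))) * cos (k * \<xi>))) \<le> 1 * (pi - (- pi))"
  proof (rule integral_bound)
    fix \<xi> :: real
    have "\<bar>exp (- \<tau> * (2 * (1 - cos \<xi>)))\<bar> * \<bar>cos (k * \<xi>)\<bar> \<le> 1 * 1"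
      using assms by (intro mult_mono) auto
    then show "norm (exp (- \<tau> * (2 * (1 - cos \<xi>))) * cos (k * \<xi>)) \<le> 1" by (simp add: abs_mult)
  qed (auto intro!: continuous_intros)
  then show ?thesis by (simp add: walk_kernel_def abs_mult field_simps)
qed

lemma walk_kernel_initial: "walk_kernel 0 (of_int k) 0 = (if k = 0 then 1 else 0)"
proof (cases "k = 0")
  case False
  have "((\<lambda>\<xi>. cos (of_int k * \<xi>)) has_integral sin (of_int k * pi) / of_int k - sin (of_int k * (- pi)) / of_int k) {-pi..pi}"
    by (rule fundamental_theorem_of_calculus)
      (auto intro!: derivative_eq_intros simp: False simp flip: has_real_derivative_iff_has_vector_derivative)
  then have "integral {-pi..pi} (\<lambda>\<xi>. cos (of_int k * \<xi>)) = 0"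
    by (simp add: integral_unique sin_times_pi_eq_0)
  then show ?thesis using False by (simp add: walk_kernel_def)
qed (simp add: walk_kernel_def)

text \<open>The substitution \<open>\<xi> = p / sqrt \<tau>\<close>.\<close>

lemma walk_kernel_rescaled:
  assumes "\<tau> > 0"
  shows "\<tau> ^ j * sqrt \<tau> * walk_kernel j k \<tau> =
    1 / (2 * pi) * (\<integral>p. indicator {p. p\<^sup>2 * (1 / \<tau>) \<le> pi\<^sup>2} p * rescaled_symbol j p (1 / \<tau>) * cos (k / sqrt \<tau> * p) \<partial>lborel)"
proof -
  define f where "f \<xi> = (- (2 * (1 - cos \<xi>))) ^ j * exp (- \<tau> * (2 * (1 - cos \<xi>))) * cos (k * \<xi>)" for \<xi>
  define s where "s = sqrt \<tau>"
  have s: "s > 0" "s\<^sup>2 = \<tau>" using assms by (auto simp: s_def)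
  have "integral {-pi..pi} f = (\<integral>\<xi>. indicator {-pi..pi} \<xi> * f \<xi> \<partial>lborel)"
  proof -
    have "continuous_on {-pi..pi} f" unfolding f_def by (intro continuous_intros)
    from borel_integrable_compact[OF _ this] have "set_integrable lborel {-pi..pi} f"
      by (simp add: set_integrable_def indicator_def if_distrib cong: if_cong)
    from set_borel_integral_eq_integral(2)[OF this] show ?thesis
      by (simp add: set_lebesgue_integral_def)
  qed
  also have "\<dots> = (1 / s) * (\<integral>p. indicator {-pi..pi} (p / s) * f (p / s) \<partial>lborel)"
    using s by (subst lborel_integral_real_affine[of "1 / s" _ 0]) auto
  also have "(\<lambda>p. indicator {-pi..pi} (p / s) * f (p / s)) =
     (\<lambda>p. (1 / \<tau> ^ j) * (indicator {p. p\<^sup>2 * (1 / \<tau>) \<le> pi\<^sup>2} p * rescaled_symbol j p (1 / \<tau>) * cos (k / s * p)))"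
  proof
    fix p
    have x: "p\<^sup>2 * (1 / \<tau>) = (p / s)\<^sup>2" using s by (simp add: power_divide)
    have "p\<^sup>2 * psi (p\<^sup>2 * (1 / \<tau>)) = \<tau> * (2 * (1 - cos (p / s)))"
      unfolding psi_eq[symmetric] x using s assms by (simp add: power_divide)
    then have r: "rescaled_symbol j p (1 / \<tau>) = (\<tau> * (- (2 * (1 - cos (p / s))))) ^ j * exp (- \<tau> * (2 * (1 - cos (p / s))))"
    proof -
      have "- p\<^sup>2 * psi (p\<^sup>2 * (1 / \<tau>)) = \<tau> * (- (2 * (1 - cos (p / s))))" and
        "\<tau> * (- (2 * (1 - cos (p / s)))) = - \<tau> * (2 * (1 - cos (p / s)))"
        unfolding minus_mult_left[symmetric] \<open>p\<^sup>2 * psi _ = _\<close> by (simp_all only: mult_minus_right)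
      then show ?thesis by (simp only: rescaled_symbol_def)
    qed
    have "(p / s)\<^sup>2 \<le> pi\<^sup>2 \<longleftrightarrow> \<bar>p / s\<bar> \<le> pi"
      using abs_le_square_iff[of "p / s" pi] by simp
    then have ind: "(indicator {p. p\<^sup>2 * (1 / \<tau>) \<le> pi\<^sup>2} p :: real) = indicator {-pi..pi} (p / s)"
      unfolding x indicator_def mem_Collect_eq atLeastAtMost_iff by (simp only: abs_le_iff) (auto)
    show "indicator {-pi..pi} (p / s) * f (p / s) =
      (1 / \<tau> ^ j) * (indicator {p. p\<^sup>2 * (1 / \<tau>) \<le> pi\<^sup>2} p * rescaled_symbol j p (1 / \<tau>) * cos (k / s * p))"
      unfolding ind r f_def power_mult_distrib using assms by simp
  qed
  also have "(\<integral>p. (1 / \<tau> ^ j) * (indicator {p. p\<^sup>2 * (1 / \<tau>) \<le> pi\<^sup>2} p * rescaled_symbol j p (1 / \<tau>) * cos (k / s * p)) \<partial>lborel)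
    = (1 / \<tau> ^ j) * (\<integral>p. indicator {p. p\<^sup>2 * (1 / \<tau>) \<le> pi\<^sup>2} p * rescaled_symbol j p (1 / \<tau>) * cos (k / s * p) \<partial>lborel)"
    by (rule integral_mult_right_zero)
  finally have "integral {-pi..pi} f = 1 / s * (1 / \<tau> ^ j *
      (\<integral>p. indicator {p. p\<^sup>2 * (1 / \<tau>) \<le> pi\<^sup>2} p * rescaled_symbol j p (1 / \<tau>) * cos (k / s * p) \<partial>lborel))" .
  moreover have "walk_kernel j k \<tau> = 1 / (2 * pi) * integral {-pi..pi} f"
    by (simp only: walk_kernel_def f_def[abs_def])
  ultimately show ?thesis using assms s by (simp add: s_def[symmetric])
qed

text \<open>The pointwise expansion of the rescaled symbol is integrated against \<open>cos (k / sqrt \<tau> * p)\<close>.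
The remainder has a Gaussian majorant independent of \<open>k\<close>, and the main terms are Fourier
transforms of even powers of \<open>p\<close> times the Gaussian, hence its derivatives of even order.\<close>

lemma walk_kernel_expansion:
  "\<exists>c D. c 0 = (\<lambda>a. if a = j then 1 else 0) \<and> D 0 = j \<and> (\<forall>m\<ge>1. c m 0 = 0) \<and>
    (\<forall>N. \<exists>R. \<forall>k. \<forall>\<tau>>0. \<bar>\<tau> ^ j * sqrt \<tau> * walk_kernel j k \<tau>
        - (\<Sum>m<N. (1 / \<tau>) ^ m * (\<Sum>a\<le>(D m::nat). c m a * gauss_deriv (2 * a) (k / sqrt \<tau>)))\<bar> \<le> R * (1 / \<tau>) ^ N)"
proof -
  obtain b0 where b0: "b0 > 0" "\<forall>s. 0 \<le> s \<and> s \<le> pi\<^sup>2 \<longrightarrow> b0 \<le> psi s" using psi_lower_bound by blast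
  define b where "b = b0 / 2"
  have b: "b > 0" "\<forall>s. 0 \<le> s \<and> s \<le> pi\<^sup>2 \<longrightarrow> 2 * b \<le> psi s" using b0 by (auto simp: b_def)
  obtain c D where c0: "c 0 = (\<lambda>a. if a = j then (-1) ^ j else 0)" "D 0 = j" "\<forall>m\<ge>1. c m 0 = 0"
    and cD: "\<forall>N. \<exists>C. \<forall>p. \<forall>d>0. \<bar>indicator {p. p\<^sup>2 * d \<le> pi\<^sup>2} p * rescaled_symbol j p d
        - (\<Sum>m<N. d ^ m * ((\<Sum>a\<le>(D m::nat). c m a * p ^ (2 * a)) * exp (- p\<^sup>2)))\<bar> \<le> C * d ^ N * exp (- b * p\<^sup>2)"
    using rescaled_symbol_expansion[OF b, of j] by blast
  have [measurable]: "(\<lambda>p. rescaled_symbol j' p d) \<in> borel_measurable borel" for j' d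
    unfolding rescaled_symbol_def[abs_def]
    by (intro borel_measurable_continuous_onI continuous_intros) auto
  have "\<exists>R. \<forall>k. \<forall>\<tau>>0. \<bar>\<tau> ^ j * sqrt \<tau> * walk_kernel j k \<tau>
        - (\<Sum>m<N. (1 / \<tau>) ^ m * (\<Sum>a\<le>D m. ((-1) ^ a * c m a) * gauss_deriv (2 * a) (k / sqrt \<tau>)))\<bar> \<le> R * (1 / \<tau>) ^ N" for N
  proof -
    from cD obtain C where C: "\<And>p d. d > 0 \<Longrightarrow> \<bar>indicator {p. p\<^sup>2 * d \<le> pi\<^sup>2} p * rescaled_symbol j p d
        - (\<Sum>m<N. d ^ m * ((\<Sum>a\<le>(D m::nat). c m a * p ^ (2 * a)) * exp (- p\<^sup>2)))\<bar> \<le> C * d ^ N * exp (- b * p\<^sup>2)"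
      by blast
    show ?thesis
    proof (intro exI allI impI)
      fix k \<tau> :: real assume \<tau>: "\<tau> > 0"
      define d y where "d = 1 / \<tau>" and "y = k / sqrt \<tau>"
      have d: "d > 0" using \<tau> by (simp add: d_def)
      define A where "A p = indicator {p. p\<^sup>2 * d \<le> pi\<^sup>2} p * rescaled_symbol j p d" for p
      define B where "B p = (\<Sum>m<N. d ^ m * ((\<Sum>a\<le>(D m::nat). c m a * p ^ (2 * a)) * exp (- p\<^sup>2)))" for p
      have g: "integrable lborel (\<lambda>p. p ^ (2 * a) * exp (- p\<^sup>2) * cos (y * p))" for a
        using integrable_power_gaussian_cos[of "2 * a" y 0] by simp
      have B_eq: "B p * cos (y * p) = (\<Sum>m<N. \<Sum>a\<le>D m. (d ^ m * c m a) * (p ^ (2 * a) * exp (- p\<^sup>2) * cos (y * p)))" for p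
        unfolding B_def sum_distrib_left sum_distrib_right by (intro sum.cong refl) simp
      have iB: "integrable lborel (\<lambda>p. B p * cos (y * p))"
        unfolding B_eq by (intro Bochner_Integration.integrable_sum integrable_mult_right g)
      have intB: "1 / (2 * pi) * (\<integral>p. B p * cos (y * p) \<partial>lborel) =
         (\<Sum>m<N. d ^ m * (\<Sum>a\<le>D m. ((-1) ^ a * c m a) * gauss_deriv (2 * a) y))"
      proof -
        have "(\<integral>p. B p * cos (y * p) \<partial>lborel) = (\<Sum>m<N. \<Sum>a\<le>D m. (d ^ m * c m a) * (\<integral>p. p ^ (2 * a) * exp (- p\<^sup>2) * cos (y * p) \<partial>lborel))"
          unfolding B_eq by (simp add: Bochner_Integration.integral_sum g)
        moreover have "(\<integral>p. p ^ (2 * a) * exp (- p\<^sup>2) * cos (y * p) \<partial>lborel) = 2 * pi * ((-1) ^ a * gauss_deriv (2 * a) y)" for a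
          unfolding gauss_deriv_even by (simp flip: power_add mult_2)
        ultimately show ?thesis
          by (simp add: sum_distrib_left mult_ac)
      qed
      have dom: "integrable lborel (\<lambda>p. C * d ^ N * exp (- b * p\<^sup>2))"
        by (intro integrable_mult_right integrable_gaussian b)
      have le: "\<bar>(A p - B p) * cos (y * p)\<bar> \<le> C * d ^ N * exp (- b * p\<^sup>2)" for p
      proof -
        have "\<bar>(A p - B p) * cos (y * p)\<bar> \<le> \<bar>A p - B p\<bar> * 1"
          unfolding abs_mult by (intro mult_left_mono) auto
        also have "\<dots> \<le> C * d ^ N * exp (- b * p\<^sup>2)" using C[OF d, of p] by (simp add: A_def B_def)
        finally show ?thesis .
      qed
      have iAB: "integrable lborel (\<lambda>p. (A p - B p) * cos (y * p))"
      proof (rule Bochner_Integration.integrable_bound[OF dom])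
        show "(\<lambda>p. (A p - B p) * cos (y * p)) \<in> borel_measurable lborel"
          unfolding A_def B_def by measurable
        show "AE p in lborel. norm ((A p - B p) * cos (y * p)) \<le> norm (C * d ^ N * exp (- b * p\<^sup>2))"
          using le by (intro AE_I2) (metis abs_ge_self order_trans real_norm_def)
      qed
      have "(\<integral>p. A p * cos (y * p) \<partial>lborel) = (\<integral>p. (A p - B p) * cos (y * p) + B p * cos (y * p) \<partial>lborel)"
        by (simp add: algebra_simps)
      also have "\<dots> = (\<integral>p. (A p - B p) * cos (y * p) \<partial>lborel) + (\<integral>p. B p * cos (y * p) \<partial>lborel)"
        by (rule Bochner_Integration.integral_add[OF iAB iB])
      finally have "\<tau> ^ j * sqrt \<tau> * walk_kernel j k \<tau> = 1 / (2 * pi) * (\<integral>p. (A p - B p) * cos (y * p) \<partial>lborel)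
          + (\<Sum>m<N. d ^ m * (\<Sum>a\<le>D m. ((-1) ^ a * c m a) * gauss_deriv (2 * a) y))"
        unfolding walk_kernel_rescaled[OF \<tau>] intB[symmetric] distrib_left[symmetric]
        by (simp add: A_def d_def y_def)
      then have "\<bar>\<tau> ^ j * sqrt \<tau> * walk_kernel j k \<tau>
        - (\<Sum>m<N. d ^ m * (\<Sum>a\<le>D m. ((-1) ^ a * c m a) * gauss_deriv (2 * a) y))\<bar>
        = 1 / (2 * pi) * \<bar>\<integral>p. (A p - B p) * cos (y * p) \<partial>lborel\<bar>"
        by (simp add: abs_mult)
      also have "\<dots> \<le> 1 / (2 * pi) * (\<integral>p. C * d ^ N * exp (- b * p\<^sup>2) \<partial>lborel)"
        by (intro mult_left_mono integral_abs_bound_integral iAB dom le) auto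
      also have "(\<integral>p. C * d ^ N * exp (- b * p\<^sup>2) \<partial>lborel) = C * d ^ N * (\<integral>p. exp (- b * p\<^sup>2) \<partial>lborel)"
        by (rule integral_mult_right_zero)
      finally show "\<bar>\<tau> ^ j * sqrt \<tau> * walk_kernel j k \<tau>
        - (\<Sum>m<N. (1 / \<tau>) ^ m * (\<Sum>a\<le>D m. ((-1) ^ a * c m a) * gauss_deriv (2 * a) (k / sqrt \<tau>)))\<bar>
        \<le> (1 / (2 * pi) * C * (\<integral>p. exp (- b * p\<^sup>2) \<partial>lborel)) * (1 / \<tau>) ^ N"
        by (simp add: d_def y_def mult_ac)
    qed
  qed
  moreover have "(\<lambda>a. (-1) ^ a * c 0 a) = (\<lambda>a. if a = j then 1 else 0)"
    by (auto simp: c0 fun_eq_iff simp flip: power_add mult_2)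
  ultimately show ?thesis
    using c0 by (intro exI[of _ "\<lambda>m a. (-1) ^ a * c m a"] exI[of _ D]) auto
qed

section \<open>The explicit Green function\<close>

text \<open>The binomial recursion behind the general Leibniz rule. It serves both for time derivatives of a
product kernel and for powers of the Laplacian applied to a product function.\<close>

lemma Leibniz_sum_Suc:
  fixes F G :: "nat \<Rightarrow> real"
  shows "(\<Sum>j\<le>Suc J. real (Suc J choose j) * F j * G (Suc J - j)) =
    (\<Sum>j\<le>J. real (J choose j) * (F (Suc j) * G (J - j) + F j * G (Suc (J - j))))"
proof -
  have "(\<Sum>j\<le>Suc J. real (Suc J choose j) * F j * G (Suc J - j))
     = F 0 * G (Suc J) + (\<Sum>j\<le>J. real (J choose j) * F (Suc j) * G (J - j) + real (J choose Suc j) * F (Suc j) * G (J - j))"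
    unfolding sum.atMost_Suc_shift by (simp add: algebra_simps)
  also have "\<dots> = (\<Sum>j\<le>J. real (J choose j) * F (Suc j) * G (J - j)) +
      (F 0 * G (Suc J) + (\<Sum>j\<le>J. real (J choose Suc j) * F (Suc j) * G (J - j)))"
    by (simp add: sum.distrib)
  also have "F 0 * G (Suc J) + (\<Sum>j\<le>J. real (J choose Suc j) * F (Suc j) * G (J - j))
     = (\<Sum>j\<le>Suc J. real (J choose j) * F j * G (Suc J - j))"
    unfolding sum.atMost_Suc_shift by simp
  also have "\<dots> = (\<Sum>j\<le>J. real (J choose j) * F j * G (Suc (J - j)))"
    by (simp add: Suc_diff_le)
  finally show ?thesis by (simp only: distrib_left mult.assoc sum.distrib)
qed

text \<open>By the Leibniz rule, the \<open>J\<close>-th time derivative of the product of two one-dimensional kernels.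
The product is the kernel of the planar walk, because the symbol of the planar Laplacian is
the sum of two one-dimensional symbols.\<close>

definition walk_kernel2 :: "nat \<Rightarrow> real \<Rightarrow> real \<Rightarrow> real \<Rightarrow> real" where
  "walk_kernel2 J k l \<tau> = (\<Sum>j\<le>J. real (J choose j) * walk_kernel j k \<tau> * walk_kernel (J - j) l \<tau>)"

lemma walk_kernel2_has_derivative:
  "(walk_kernel2 J k l has_real_derivative walk_kernel2 (Suc J) k l \<tau>) (at \<tau>)"
proof -
  have "((\<lambda>\<tau>. \<Sum>j\<le>J. real (J choose j) * walk_kernel j k \<tau> * walk_kernel (J - j) l \<tau>) has_real_derivative
     (\<Sum>j\<le>J. real (J choose j) * (walk_kernel (Suc j) k \<tau> * walk_kernel (J - j) l \<tau> + walk_kernel j k \<tau> * walk_kernel (Suc (J - j)) l \<tau>))) (at \<tau>)"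
    unfolding mult.assoc
    by (intro DERIV_sum DERIV_cmult) (auto intro!: derivative_eq_intros walk_kernel_has_derivative)
  then show ?thesis
    unfolding walk_kernel2_def[abs_def] Leibniz_sum_Suc[of J "\<lambda>j. walk_kernel j k \<tau>" "\<lambda>j. walk_kernel j l \<tau>"] .
qed

definition green_formula :: "real \<Rightarrow> nat \<Rightarrow> real^2 \<Rightarrow> real \<Rightarrow> real" where
  "green_formula \<epsilon> J x t = (1 / \<epsilon>\<^sup>2) ^ Suc J * walk_kernel2 J (x $ 1 / \<epsilon>) (x $ 2 / \<epsilon>) (t / \<epsilon>\<^sup>2)"

lemma green_formula_has_derivative:
  "(green_formula \<epsilon> J x has_real_derivative green_formula \<epsilon> (Suc J) x t) (at t)"
proof -
  have "((\<lambda>t. walk_kernel2 J (x $ 1 / \<epsilon>) (x $ 2 / \<epsilon>) (t / \<epsilon>\<^sup>2)) has_real_derivative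
     walk_kernel2 (Suc J) (x $ 1 / \<epsilon>) (x $ 2 / \<epsilon>) (t / \<epsilon>\<^sup>2) * (1 / \<epsilon>\<^sup>2)) (at t)"
    by (rule DERIV_chain2[OF walk_kernel2_has_derivative]) (rule DERIV_cdivide[OF DERIV_ident])
  from DERIV_cmult[OF this, of "(1 / \<epsilon>\<^sup>2) ^ Suc J"] show ?thesis
    by (simp add: green_formula_def[abs_def] mult_ac)
qed

lemma axis_components:
  "(x + axis 1 h) $ 1 = x $ 1 + h" "(x + axis 1 h) $ 2 = x $ 2"
  "(x + axis 2 h) $ 2 = x $ 2 + h" "(x + axis 2 h) $ 1 = x $ 1"
  "(x - axis 1 h) $ 1 = x $ 1 - h" "(x - axis 1 h) $ 2 = x $ 2"
  "(x - axis 2 h) $ 2 = x $ 2 - h" "(x - axis 2 h) $ 1 = x $ 1" for x :: "real^2" and h :: real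
  by (simp_all add: axis_def)

lemma green_formula_heat_equation:
  assumes "\<epsilon> > 0"
  shows "green_formula \<epsilon> (Suc 0) x t = discrete_laplacian \<epsilon> (\<lambda>z. green_formula \<epsilon> 0 z t) x"
  using assms unfolding discrete_laplacian_def green_formula_def walk_kernel2_def axis_components
  by (simp add: walk_kernel_heat_equation add_divide_distrib diff_divide_distrib) (simp add: field_simps)

lemma grid_shift:
  assumes "x \<in> grid \<epsilon>"
  shows "x + axis i \<epsilon> \<in> grid \<epsilon>" "x - axis i \<epsilon> \<in> grid \<epsilon>"
proof -
  obtain s :: "int^2" where s: "x = \<epsilon> *\<^sub>R (\<chi> i. real_of_int (s $ i))" using assms by (auto simp: grid_def)
  have "x + axis i \<epsilon> = \<epsilon> *\<^sub>R (\<chi> j. real_of_int ((s + axis i 1) $ j))"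
    "x - axis i \<epsilon> = \<epsilon> *\<^sub>R (\<chi> j. real_of_int ((s - axis i 1) $ j))"
    by (auto simp: s vec_eq_iff axis_def algebra_simps)
  then show "x + axis i \<epsilon> \<in> grid \<epsilon>" "x - axis i \<epsilon> \<in> grid \<epsilon>" unfolding grid_def by blast+
qed

lemma discrete_laplacian_bound:
  assumes "x \<in> grid \<epsilon>" "\<forall>z\<in>grid \<epsilon>. \<bar>w z\<bar> \<le> M"
  shows "\<bar>discrete_laplacian \<epsilon> w x\<bar> \<le> 8 / \<epsilon>\<^sup>2 * M"
proof -
  have "\<bar>w (x + axis 1 \<epsilon>) + w (x - axis 1 \<epsilon>) + w (x + axis 2 \<epsilon>) + w (x - axis 2 \<epsilon>) - 4 * w x\<bar> \<le> 8 * M"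
    using assms(2)[rule_format, OF assms(1)] assms(2)[rule_format, OF grid_shift(1)[OF assms(1), of 1]]
      assms(2)[rule_format, OF grid_shift(1)[OF assms(1), of 2]] assms(2)[rule_format, OF grid_shift(2)[OF assms(1), of 1]]
      assms(2)[rule_format, OF grid_shift(2)[OF assms(1), of 2]] by linarith
  then show ?thesis unfolding discrete_laplacian_def by (simp add: abs_divide divide_right_mono)
qed

text \<open>The difference of the two sides is bounded in space for each time, starts at zero and is driven by
the discrete Laplacian, which has norm at most \<open>8 / \<epsilon>\<^sup>2\<close> on bounded grid functions. So
\<open>pointwise_bounded_flow_zero\<close> applies.\<close>

lemma green_function_eq_formula:
  assumes \<epsilon>: "\<epsilon> > 0" and u: "first_green_function \<epsilon> u" and x: "x \<in> grid \<epsilon>" and t: "t \<ge> 0"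
  shows "u x t = green_formula \<epsilon> 0 x t"
proof -
  let ?v = "green_formula \<epsilon> 0"
  define w where "w x t = u x t - ?v x t" for x t
  have "w x t = 0"
  proof (rule pointwise_bounded_flow_zero[where w = w and x = x and t = t and X = "grid \<epsilon>" and D = "\<lambda>x t. discrete_laplacian \<epsilon> (\<lambda>z. w z t) x"
        and K = "8 / \<epsilon>\<^sup>2"])
    fix x assume x: "x \<in> grid \<epsilon>"
    obtain u' where u': "\<forall>t\<ge>0. (u x has_real_derivative u' t) (at t within {0..})"
      using u x by (auto simp: first_green_function_def C1_nonneg_def)
    have "continuous_on {0..} (u x)"
      using u' by (auto simp: continuous_on_eq_continuous_within intro: DERIV_continuous)
    moreover have "continuous_on {0..} (?v x)"
      by (rule DERIV_continuous_on[OF has_field_derivative_at_within[OF green_formula_has_derivative]])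
    ultimately show "continuous_on {0..} (w x)" unfolding w_def[abs_def] by (intro continuous_on_diff)
    show "(w x has_real_derivative discrete_laplacian \<epsilon> (\<lambda>z. w z t) x) (at t)" if t: "0 < t" for t
    proof -
      have "at t within {0..} = at t" using t by (intro at_within_interior) simp
      then have "(u x has_real_derivative u' t) (at t)" using u' t by (metis less_imp_le)
      then have "(u x has_real_derivative discrete_laplacian \<epsilon> (\<lambda>z. u z t) x) (at t)"
        using u x t DERIV_imp_deriv by (fastforce simp: first_green_function_def)
      moreover have "(?v x has_real_derivative discrete_laplacian \<epsilon> (\<lambda>z. ?v z t) x) (at t)"
        using green_formula_has_derivative[of \<epsilon> 0 x t] green_formula_heat_equation[OF \<epsilon>] by simp
      ultimately have "(w x has_real_derivative discrete_laplacian \<epsilon> (\<lambda>z. u z t) x - discrete_laplacian \<epsilon> (\<lambda>z. ?v z t) x) (at t)"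
        unfolding w_def[abs_def] by (rule DERIV_diff)
      also have "discrete_laplacian \<epsilon> (\<lambda>z. u z t) x - discrete_laplacian \<epsilon> (\<lambda>z. ?v z t) x = discrete_laplacian \<epsilon> (\<lambda>z. w z t) x"
        by (simp add: discrete_laplacian_def w_def diff_divide_distrib[symmetric])
      finally show ?thesis .
    qed
    show "w x 0 = 0"
    proof -
      obtain s :: "int^2" where s: "x = \<epsilon> *\<^sub>R (\<chi> i. real_of_int (s $ i))" using x by (auto simp: grid_def)
      have "x = 0 \<longleftrightarrow> s $ 1 = 0 \<and> s $ 2 = 0" using \<epsilon> by (simp add: s vec_eq_iff forall_2)
      moreover have "u x 0 = grid_delta \<epsilon> x" using u x by (simp add: first_green_function_def)
      moreover have "x $ 1 / \<epsilon> = of_int (s $ 1)" "x $ 2 / \<epsilon> = of_int (s $ 2)" using \<epsilon> by (simp_all add: s)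
      ultimately show ?thesis
        by (simp add: w_def green_formula_def walk_kernel2_def walk_kernel_initial grid_delta_def)
    qed
  next
    fix t :: real assume t: "0 \<le> t"
    have "rapidly_decreasing_on_grid \<epsilon> (\<lambda>x. u x t)" using u t by (simp add: first_green_function_def)
    then obtain C where C: "\<forall>x\<in>grid \<epsilon>. norm x ^ 0 * \<bar>u x t\<bar> \<le> C"
      unfolding rapidly_decreasing_on_grid_def by blast
    have "\<bar>?v x t\<bar> \<le> 1 / \<epsilon>\<^sup>2 * (1 * 1)" for x
    proof -
      have "\<bar>?v x t\<bar> = 1 / \<epsilon>\<^sup>2 * (\<bar>walk_kernel 0 (x $ 1 / \<epsilon>) (t / \<epsilon>\<^sup>2)\<bar> * \<bar>walk_kernel 0 (x $ 2 / \<epsilon>) (t / \<epsilon>\<^sup>2)\<bar>)"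
        by (simp add: green_formula_def walk_kernel2_def abs_mult)
      also have "\<dots> \<le> 1 / \<epsilon>\<^sup>2 * (1 * 1)"
        using t by (intro mult_left_mono mult_mono walk_kernel_bounded) auto
      finally show ?thesis .
    qed
    then show "\<exists>M. \<forall>x\<in>grid \<epsilon>. \<bar>w x t\<bar> \<le> M"
    proof (intro exI[of _ "C + 1 / \<epsilon>\<^sup>2"] ballI)
      fix x assume x: "x \<in> grid \<epsilon>"
      have "\<bar>w x t\<bar> \<le> \<bar>u x t\<bar> + \<bar>?v x t\<bar>" unfolding w_def by (rule abs_triangle_ineq4)
      moreover have "\<bar>u x t\<bar> \<le> C" using C x by simp
      moreover have "\<bar>?v x t\<bar> \<le> 1 / \<epsilon>\<^sup>2" using \<open>\<And>x. \<bar>?v x t\<bar> \<le> 1 / \<epsilon>\<^sup>2 * (1 * 1)\<close>[of x] by simp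
      ultimately show "\<bar>w x t\<bar> \<le> C + 1 / \<epsilon>\<^sup>2" by linarith
    qed
  next
    show "\<bar>discrete_laplacian \<epsilon> (\<lambda>z. w z t) x\<bar> \<le> 8 / \<epsilon>\<^sup>2 * M"
      if "x \<in> grid \<epsilon>" "\<forall>z\<in>grid \<epsilon>. \<bar>w z t\<bar> \<le> M" for x t M
      using that by (rule discrete_laplacian_bound)
  qed (use \<epsilon> x t in simp_all)
  then show ?thesis by (simp add: w_def)
qed

text \<open>Derivatives at a positive time only see times nearby, so agreement on the open half-line
suffices, whatever \<open>f\<close> is at negative times.\<close>

lemma iterated_deriv_eq:
  fixes f :: "real \<Rightarrow> real"
  assumes "\<And>t. t > 0 \<Longrightarrow> f t = V 0 t"
    and V: "\<And>n t. t > 0 \<Longrightarrow> (V n has_real_derivative V (Suc n) t) (at t)"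
    and "t > 0"
  shows "(deriv ^^ n) f t = V n t" "(deriv ^^ n) f differentiable (at t)"
proof -
  have der: "(g has_real_derivative V (Suc n) t) (at t)" if "\<forall>t>0. g t = V n t" "t > 0" for g n t
    by (rule has_field_derivative_transform_within_open[OF V[OF that(2)], of "{0<..}"]) (use that in auto)
  have eq: "\<forall>t>0. (deriv ^^ n) f t = V n t" for n
  proof (induction n)
    case 0
    then show ?case using assms(1) by simp
  next
    case (Suc n)
    show ?case
    proof (intro allI impI)
      fix t :: real assume "t > 0"
      from DERIV_imp_deriv[OF der[OF Suc this]] show "(deriv ^^ Suc n) f t = V (Suc n) t" by simp
    qed
  qed
  show "(deriv ^^ n) f t = V n t" "(deriv ^^ n) f differentiable (at t)"
    using eq[of n] der[OF eq] \<open>t > 0\<close> unfolding real_differentiable_def by blast+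
qed

section \<open>Products of asymptotic expansions\<close>

text \<open>To compare with the Cauchy product truncated at total order \<open>N\<close>, the \<open>m\<close>-th term of the first
expansion is multiplied by the second factor expanded to order \<open>N - m\<close>, so that every error term has
order exactly \<open>N\<close>. The remainder of \<open>A\<close> is multiplied by all of \<open>B\<close>, which is bounded by its
expansion of order zero.\<close>

lemma expansion_product:
  fixes A B \<sigma> :: "'a \<Rightarrow> real" and \<alpha> \<beta> :: "nat \<Rightarrow> 'a \<Rightarrow> real"
  assumes \<sigma>: "\<And>p. p \<in> S \<Longrightarrow> 0 \<le> \<sigma> p"
    and A: "\<And>N. \<exists>R. \<forall>p\<in>S. \<bar>A p - (\<Sum>m<N. \<sigma> p ^ m * \<alpha> m p)\<bar> \<le> R * \<sigma> p ^ N"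
    and B: "\<And>N. \<exists>R. \<forall>p\<in>S. \<bar>B p - (\<Sum>m<N. \<sigma> p ^ m * \<beta> m p)\<bar> \<le> R * \<sigma> p ^ N"
    and bdd: "\<And>m. \<exists>M. \<forall>p\<in>S. \<bar>\<alpha> m p\<bar> \<le> M"
  shows "\<exists>R. \<forall>p\<in>S. \<bar>A p * B p - (\<Sum>n<N. \<sigma> p ^ n * (\<Sum>m\<le>n. \<alpha> m p * \<beta> (n - m) p))\<bar> \<le> R * \<sigma> p ^ N"
proof -
  from A obtain RA where RA: "\<And>N p. p \<in> S \<Longrightarrow> \<bar>A p - (\<Sum>m<N. \<sigma> p ^ m * \<alpha> m p)\<bar> \<le> RA N * \<sigma> p ^ N" by metis
  from B obtain RB where RB: "\<And>N p. p \<in> S \<Longrightarrow> \<bar>B p - (\<Sum>m<N. \<sigma> p ^ m * \<beta> m p)\<bar> \<le> RB N * \<sigma> p ^ N" by metis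
  from bdd obtain M where M: "\<And>m p. p \<in> S \<Longrightarrow> \<bar>\<alpha> m p\<bar> \<le> M m" by metis
  show ?thesis
  proof (intro exI ballI)
    fix p assume p: "p \<in> S"
    define rA where "rA = A p - (\<Sum>m<N. \<sigma> p ^ m * \<alpha> m p)"
    define rB where "rB N = B p - (\<Sum>m<N. \<sigma> p ^ m * \<beta> m p)" for N
    have "(\<Sum>n<N. \<sigma> p ^ n * (\<Sum>m\<le>n. \<alpha> m p * \<beta> (n - m) p))
       = (\<Sum>n<N. \<Sum>m\<le>n. (\<sigma> p ^ m * \<alpha> m p) * (\<sigma> p ^ (n - m) * \<beta> (n - m) p))"
      unfolding sum_distrib_left
    proof (intro sum.cong refl)
      fix n m :: nat assume "m \<in> {..n}"
      then have "\<sigma> p ^ n = \<sigma> p ^ m * \<sigma> p ^ (n - m)" by (simp flip: power_add)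
      then show "\<sigma> p ^ n * (\<alpha> m p * \<beta> (n - m) p) = (\<sigma> p ^ m * \<alpha> m p) * (\<sigma> p ^ (n - m) * \<beta> (n - m) p)" by simp
    qed
    also have "\<dots> = (\<Sum>(m, l)\<in>{(m, l). m + l < N}. (\<sigma> p ^ m * \<alpha> m p) * (\<sigma> p ^ l * \<beta> l p))"
      by (rule sum.triangle_reindex[symmetric])
    also have "{(m, l). m + l < N} = Sigma {..<N} (\<lambda>m. {..<N - m})" by auto
    also have "(\<Sum>(m, l)\<in>Sigma {..<N} (\<lambda>m. {..<N - m}). (\<sigma> p ^ m * \<alpha> m p) * (\<sigma> p ^ l * \<beta> l p))
       = (\<Sum>m<N. (\<sigma> p ^ m * \<alpha> m p) * (\<Sum>l<N - m. \<sigma> p ^ l * \<beta> l p))"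
      by (subst sum.Sigma[symmetric]) (auto simp: sum_distrib_left)
    also have "\<dots> = (\<Sum>m<N. (\<sigma> p ^ m * \<alpha> m p) * (B p - rB (N - m)))" by (simp add: rB_def)
    also have "\<dots> = (\<Sum>m<N. \<sigma> p ^ m * \<alpha> m p) * B p - (\<Sum>m<N. (\<sigma> p ^ m * \<alpha> m p) * rB (N - m))"
      by (simp add: right_diff_distrib sum_subtractf sum_distrib_right)
    finally have eq: "A p * B p - (\<Sum>n<N. \<sigma> p ^ n * (\<Sum>m\<le>n. \<alpha> m p * \<beta> (n - m) p))
       = rA * B p + (\<Sum>m<N. (\<sigma> p ^ m * \<alpha> m p) * rB (N - m))"
      by (simp add: rA_def left_diff_distrib)
    have "\<bar>rA * B p + (\<Sum>m<N. (\<sigma> p ^ m * \<alpha> m p) * rB (N - m))\<bar>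
        \<le> \<bar>rA * B p\<bar> + \<bar>\<Sum>m<N. (\<sigma> p ^ m * \<alpha> m p) * rB (N - m)\<bar>"
      by (rule abs_triangle_ineq)
    also have "\<dots> \<le> \<bar>rA\<bar> * \<bar>B p\<bar> + (\<Sum>m<N. \<bar>(\<sigma> p ^ m * \<alpha> m p) * rB (N - m)\<bar>)"
      unfolding abs_mult[of rA] by (intro add_mono sum_abs order_refl)
    also have "\<dots> \<le> (RA N * \<sigma> p ^ N) * RB 0 + (\<Sum>m<N. M m * RB (N - m) * \<sigma> p ^ N)"
    proof (intro add_mono sum_mono mult_mono)
      show "\<bar>rA\<bar> \<le> RA N * \<sigma> p ^ N" "\<bar>B p\<bar> \<le> RB 0" using RA[OF p, of N] RB[OF p, of 0] by (auto simp: rA_def)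
      then show "0 \<le> RA N * \<sigma> p ^ N" by linarith
      fix m assume "m \<in> {..<N}"
      then have N: "\<sigma> p ^ N = \<sigma> p ^ m * \<sigma> p ^ (N - m)" by (simp flip: power_add)
      have "\<bar>\<sigma> p ^ m * \<alpha> m p * rB (N - m)\<bar> = \<sigma> p ^ m * (\<bar>\<alpha> m p\<bar> * \<bar>rB (N - m)\<bar>)"
        using \<sigma>[OF p] by (simp add: abs_mult)
      also have "\<dots> \<le> \<sigma> p ^ m * (M m * (RB (N - m) * \<sigma> p ^ (N - m)))"
        using M[OF p, of m] RB[OF p, of "N - m"] \<sigma>[OF p] unfolding rB_def
        by (intro mult_left_mono mult_mono) auto
      finally show "\<bar>\<sigma> p ^ m * \<alpha> m p * rB (N - m)\<bar> \<le> M m * RB (N - m) * \<sigma> p ^ N" by (simp add: N mult_ac)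
    qed auto
    finally show "\<bar>A p * B p - (\<Sum>n<N. \<sigma> p ^ n * (\<Sum>m\<le>n. \<alpha> m p * \<beta> (n - m) p))\<bar>
      \<le> (RA N * RB 0 + (\<Sum>m<N. M m * RB (N - m))) * \<sigma> p ^ N"
      unfolding eq distrib_right sum_distrib_right by (simp only: mult_ac)
  qed
qed

section \<open>Derivatives of the heat profile and the expansion\<close>

definition gauss_monomial :: "nat \<Rightarrow> nat \<Rightarrow> real^2 \<Rightarrow> real" where
  "gauss_monomial a b y = gauss_deriv a (y $ 1) * gauss_deriv b (y $ 2)"

lemma heat_profile_eq: "heat_profile = gauss_monomial 0 0"
proof
  fix y :: "real^2"
  have "(norm y)\<^sup>2 = (y $ 1)\<^sup>2 + (y $ 2)\<^sup>2"
    unfolding power2_norm_eq_inner inner_vec_def sum_2 by (simp add: power2_eq_square)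
  then have "exp (- (norm y)\<^sup>2 / 4) = exp (- (y $ 1)\<^sup>2 / 4) * exp (- (y $ 2)\<^sup>2 / 4)"
    by (simp add: diff_divide_distrib flip: exp_add)
  then show "heat_profile y = gauss_monomial 0 0 y"
    by (simp add: heat_profile_def gauss_monomial_def gauss_deriv_0)
qed

lemma partial_deriv_gauss_sum:
  "partial_deriv 1 (\<lambda>y. \<Sum>i\<in>I. C i * gauss_monomial (p i) (q i) y) = (\<lambda>y. \<Sum>i\<in>I. C i * gauss_monomial (Suc (p i)) (q i) y)"
  "partial_deriv 2 (\<lambda>y. \<Sum>i\<in>I. C i * gauss_monomial (p i) (q i) y) = (\<lambda>y. \<Sum>i\<in>I. C i * gauss_monomial (p i) (Suc (q i)) y)"
proof -
  have shift: "((\<lambda>h. gauss_deriv n (z + h)) has_real_derivative gauss_deriv (Suc n) z) (at 0)" for n z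
    using gauss_deriv_has_derivative[of n z] DERIV_shift[of "gauss_deriv n" "gauss_deriv (Suc n) z" 0 z]
    by (simp add: add.commute)
  show "partial_deriv 1 (\<lambda>y. \<Sum>i\<in>I. C i * gauss_monomial (p i) (q i) y) = (\<lambda>y. \<Sum>i\<in>I. C i * gauss_monomial (Suc (p i)) (q i) y)"
    unfolding partial_deriv_def gauss_monomial_def axis_components
    by (intro ext DERIV_imp_deriv DERIV_sum DERIV_cmult DERIV_cmult_right shift)
  show "partial_deriv 2 (\<lambda>y. \<Sum>i\<in>I. C i * gauss_monomial (p i) (q i) y) = (\<lambda>y. \<Sum>i\<in>I. C i * gauss_monomial (p i) (Suc (q i)) y)"
    unfolding partial_deriv_def gauss_monomial_def axis_components
    by (intro ext DERIV_imp_deriv DERIV_sum DERIV_cmult shift)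
qed

lemma partial_deriv_gauss_monomial:
  "partial_deriv 1 (gauss_monomial a b) = gauss_monomial (Suc a) b"
  "partial_deriv 2 (gauss_monomial a b) = gauss_monomial a (Suc b)"
  using partial_deriv_gauss_sum[where I = "{()}" and C = "\<lambda>_. 1" and p = "\<lambda>_. a" and q = "\<lambda>_. b"] by simp_all

lemma iterated_partial_deriv_heat_profile:
  "(partial_deriv 1 ^^ a) ((partial_deriv 2 ^^ b) heat_profile) = gauss_monomial a b"
proof -
  have "(partial_deriv 2 ^^ b) heat_profile = gauss_monomial 0 b"
    by (induction b) (simp_all add: heat_profile_eq partial_deriv_gauss_monomial)
  then show ?thesis by (induction a) (simp_all add: partial_deriv_gauss_monomial)
qed

lemma iterated_laplacian_heat_profile:
  "(laplacian ^^ J) heat_profile = (\<lambda>y. \<Sum>j\<le>J. real (J choose j) * gauss_monomial (2 * j) (2 * (J - j)) y)"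
proof (induction J)
  case 0
  show ?case by (simp add: heat_profile_eq)
next
  case (Suc J)
  have "(laplacian ^^ Suc J) heat_profile y = (\<Sum>j\<le>Suc J. real (Suc J choose j) * gauss_monomial (2 * j) (2 * (Suc J - j)) y)" for y
  proof -
    have "(laplacian ^^ Suc J) heat_profile y =
        (\<Sum>j\<le>J. real (J choose j) * gauss_monomial (Suc (Suc (2 * j))) (2 * (J - j)) y) +
        (\<Sum>j\<le>J. real (J choose j) * gauss_monomial (2 * j) (Suc (Suc (2 * (J - j)))) y)"
      unfolding funpow.simps comp_def Suc laplacian_def partial_deriv_gauss_sum ..
    also have "\<dots> = (\<Sum>j\<le>J. real (J choose j) * (gauss_deriv (2 * Suc j) (y $ 1) * gauss_deriv (2 * (J - j)) (y $ 2)
         + gauss_deriv (2 * j) (y $ 1) * gauss_deriv (2 * Suc (J - j)) (y $ 2)))"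
      by (simp add: gauss_monomial_def sum.distrib[symmetric] distrib_left)
    also have "\<dots> = (\<Sum>j\<le>Suc J. real (Suc J choose j) * gauss_deriv (2 * j) (y $ 1) * gauss_deriv (2 * (Suc J - j)) (y $ 2))"
      by (rule Leibniz_sum_Suc[symmetric])
    finally show ?thesis by (simp only: gauss_monomial_def mult.assoc)
  qed
  then show ?case by (rule ext)
qed

lemma lin_comb_of_partials_monomial:
  assumes "(a, b) \<noteq> (0, 0) \<or> C = 0"
  shows "lin_comb_of_partials (\<lambda>y. C * gauss_monomial a b y) heat_profile"
proof (cases "C = 0")
  case True
  then show ?thesis unfolding lin_comb_of_partials_def by (intro exI[of _ "{}"]) simp
next
  case False
  then show ?thesis using assms
    unfolding lin_comb_of_partials_def iterated_partial_deriv_heat_profile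
    by (intro exI[of _ "{(a, b)}"] exI[of _ "\<lambda>_ _. C"]) auto
qed

lemma lin_comb_of_partials_add:
  assumes "lin_comb_of_partials f g" "lin_comb_of_partials f' g"
  shows "lin_comb_of_partials (\<lambda>y. f y + f' y) g"
proof -
  let ?d = "\<lambda>z. (partial_deriv 1 ^^ fst z) ((partial_deriv 2 ^^ snd z) g)"
  obtain S c where S: "finite S" "(0, 0) \<notin> S" "\<forall>y. f y = (\<Sum>z\<in>S. c (fst z) (snd z) * ?d z y)"
    using assms(1) unfolding lin_comb_of_partials_def split_beta by blast
  obtain S' c' where S': "finite S'" "(0, 0) \<notin> S'" "\<forall>y. f' y = (\<Sum>z\<in>S'. c' (fst z) (snd z) * ?d z y)"
    using assms(2) unfolding lin_comb_of_partials_def split_beta by blast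
  define e where "e a b = (if (a, b) \<in> S then c a b else 0) + (if (a, b) \<in> S' then c' a b else 0)" for a b
  have "f y + f' y = (\<Sum>z\<in>S \<union> S'. e (fst z) (snd z) * ?d z y)" for y
  proof -
    have "f y = (\<Sum>z\<in>S \<union> S'. (if z \<in> S then c (fst z) (snd z) else 0) * ?d z y)"
      unfolding S(3)[rule_format] using S S' by (intro sum.mono_neutral_cong_left) auto
    moreover have "f' y = (\<Sum>z\<in>S \<union> S'. (if z \<in> S' then c' (fst z) (snd z) else 0) * ?d z y)"
      unfolding S'(3)[rule_format] using S S' by (intro sum.mono_neutral_cong_left) auto
    ultimately show ?thesis by (simp add: e_def distrib_right sum.distrib)
  qed
  then show ?thesis unfolding lin_comb_of_partials_def split_beta
    using S S' by (intro exI[of _ "S \<union> S'"] exI[of _ e]) auto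
qed

lemma lin_comb_of_partials_sum:
  assumes "finite I" "\<And>i. i \<in> I \<Longrightarrow> lin_comb_of_partials (f i) heat_profile"
  shows "lin_comb_of_partials (\<lambda>y. \<Sum>i\<in>I. f i y) heat_profile"
  using assms
proof (induction I rule: finite_induct)
  case empty
  show ?case using lin_comb_of_partials_monomial[of 0 0 0] by simp
next
  case (insert i I)
  then show ?case by (simp add: lin_comb_of_partials_add)
qed

text \<open>Expansions of the two factors are multiplied in each term of the Leibniz sum. In a product of
coefficients of orders \<open>m\<close> and \<open>n - m\<close> with \<open>n \<ge> 1\<close>, at least one order is positive, so its
coefficient of the undifferentiated Gaussian vanishes and so does that of the product. At order zero
only the pure derivatives of order \<open>2 * j\<close> and \<open>2 * (J - j)\<close> remain, and their binomial sum is the power of the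
Laplacian. The vector \<open>y\<close> stands for the parabolically rescaled position.\<close>

lemma walk_kernel2_expansion:
  "\<exists>H. H 0 = (laplacian ^^ J) heat_profile \<and> (\<forall>n\<ge>1. lin_comb_of_partials (H n) heat_profile) \<and>
    (\<forall>N. \<exists>R\<ge>0. \<forall>k l. \<forall>\<tau>>0. \<forall>y :: real^2. y $ 1 = k / sqrt \<tau> \<and> y $ 2 = l / sqrt \<tau> \<longrightarrow>
      \<bar>\<tau> ^ Suc J * walk_kernel2 J k l \<tau> - (\<Sum>n<N. (1 / \<tau>) ^ n * H n y)\<bar> \<le> R * (1 / \<tau>) ^ N)"
proof -
  have "\<forall>j. \<exists>c D. c 0 = (\<lambda>a. if a = j then 1 else 0) \<and> D 0 = j \<and> (\<forall>m\<ge>1. c m 0 = 0) \<and>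
    (\<forall>N. \<exists>R. \<forall>k. \<forall>\<tau>>0. \<bar>\<tau> ^ j * sqrt \<tau> * walk_kernel j k \<tau>
        - (\<Sum>m<N. (1 / \<tau>) ^ m * (\<Sum>a\<le>(D m::nat). c m a * gauss_deriv (2 * a) (k / sqrt \<tau>)))\<bar> \<le> R * (1 / \<tau>) ^ N)"
    (is "\<forall>j. \<exists>c D. ?P j c D")
    using walk_kernel_expansion by blast
  then obtain c where "\<forall>j. \<exists>D. ?P j (c j) D" using choice[of "\<lambda>j c. \<exists>D. ?P j c D"] by blast
  then obtain D where cD: "\<forall>j. ?P j (c j) (D j)" using choice[of "\<lambda>j D. ?P j (c j) D"] by blast
  have c0: "c j 0 = (\<lambda>a. if a = j then 1 else 0)" "D j 0 = j" and c1: "m \<ge> 1 \<Longrightarrow> c j m 0 = 0" for j m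
    using cD by blast+
  define \<kappa> where "\<kappa> j m z = (\<Sum>a\<le>D j m. c j m a * gauss_deriv (2 * a) z)" for j m z
  have exp1: "\<exists>R. \<forall>k. \<forall>\<tau>>0. \<bar>\<tau> ^ j * sqrt \<tau> * walk_kernel j k \<tau> - (\<Sum>m<N. (1 / \<tau>) ^ m * \<kappa> j m (k / sqrt \<tau>))\<bar> \<le> R * (1 / \<tau>) ^ N" for j N
    using cD unfolding \<kappa>_def by blast
  have \<kappa>_bdd: "\<exists>M. \<forall>z. \<bar>\<kappa> j m z\<bar> \<le> M" for j m
  proof -
    obtain M where M: "\<And>n z. \<bar>gauss_deriv n z\<bar> \<le> M n" using gauss_deriv_bounded by metis
    have "\<bar>\<kappa> j m z\<bar> \<le> (\<Sum>a\<le>D j m. \<bar>c j m a\<bar> * M (2 * a))" for z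
      unfolding \<kappa>_def by (rule order_trans[OF sum_abs]) (auto simp: abs_mult intro!: sum_mono mult_left_mono M)
    then show ?thesis by blast
  qed
  define H where "H n y = (\<Sum>j\<le>J. real (J choose j) * (\<Sum>m\<le>n. \<kappa> j m (y $ 1) * \<kappa> (J - j) (n - m) (y $ 2)))" for n and y :: "real^2"
  have \<kappa>0: "\<kappa> j 0 z = gauss_deriv (2 * j) z" for j z
  proof -
    have "\<kappa> j 0 z = (\<Sum>a\<le>j. if a = j then gauss_deriv (2 * a) z else 0)"
      unfolding \<kappa>_def c0 by (intro sum.cong) auto
    then show ?thesis by simp
  qed
  have H0: "H 0 = (laplacian ^^ J) heat_profile"
    unfolding iterated_laplacian_heat_profile H_def[abs_def] by (simp add: \<kappa>0 gauss_monomial_def)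
  have lin: "lin_comb_of_partials (H n) heat_profile" if n: "n \<ge> 1" for n
  proof -
    have Hn: "H n = (\<lambda>y. \<Sum>j\<le>J. \<Sum>m\<le>n. \<Sum>a\<le>D j m. \<Sum>b\<le>D (J - j) (n - m).
        (real (J choose j) * (c j m a * c (J - j) (n - m) b)) * gauss_monomial (2 * a) (2 * b) y)"
    proof
      fix y
      have "H n y = (\<Sum>j\<le>J. \<Sum>m\<le>n. real (J choose j) * (\<kappa> j m (y $ 1) * \<kappa> (J - j) (n - m) (y $ 2)))"
        by (simp only: H_def sum_distrib_left)
      also have "\<dots> = (\<Sum>j\<le>J. \<Sum>m\<le>n. \<Sum>a\<le>D j m. \<Sum>b\<le>D (J - j) (n - m).
        (real (J choose j) * (c j m a * c (J - j) (n - m) b)) * gauss_monomial (2 * a) (2 * b) y)"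
      proof (intro sum.cong refl)
        fix j m
        have prod: "\<kappa> j m (y $ 1) * \<kappa> (J - j) (n - m) (y $ 2) = (\<Sum>a\<le>D j m. \<Sum>b\<le>D (J - j) (n - m).
            (c j m a * gauss_deriv (2 * a) (y $ 1)) * (c (J - j) (n - m) b * gauss_deriv (2 * b) (y $ 2)))"
          unfolding \<kappa>_def by (rule sum_product)
        show "real (J choose j) * (\<kappa> j m (y $ 1) * \<kappa> (J - j) (n - m) (y $ 2)) =
          (\<Sum>a\<le>D j m. \<Sum>b\<le>D (J - j) (n - m).
            (real (J choose j) * (c j m a * c (J - j) (n - m) b)) * gauss_monomial (2 * a) (2 * b) y)"
          unfolding gauss_monomial_def prod sum_distrib_left by (intro sum.cong refl) simp
      qed
      finally show "H n y = (\<Sum>j\<le>J. \<Sum>m\<le>n. \<Sum>a\<le>D j m. \<Sum>b\<le>D (J - j) (n - m).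
        (real (J choose j) * (c j m a * c (J - j) (n - m) b)) * gauss_monomial (2 * a) (2 * b) y)" .
    qed
    show ?thesis
      unfolding Hn
    proof (intro lin_comb_of_partials_sum lin_comb_of_partials_monomial finite_atMost)
      fix j m a b
      show "(2 * a, 2 * b) \<noteq> (0, 0) \<or> real (J choose j) * (c j m a * c (J - j) (n - m) b) = 0"
      proof (cases "a = 0 \<and> b = 0 \<and> m = 0")
        case True
        then show ?thesis using c1[of n "J - j"] n by simp
      next
        case False
        then show ?thesis using c1[of m j] by auto
      qed
    qed
  qed
  have rem: "\<exists>R\<ge>0. \<forall>k l. \<forall>\<tau>>0. \<forall>y :: real^2. y $ 1 = k / sqrt \<tau> \<and> y $ 2 = l / sqrt \<tau> \<longrightarrow>
      \<bar>\<tau> ^ Suc J * walk_kernel2 J k l \<tau> - (\<Sum>n<N. (1 / \<tau>) ^ n * H n y)\<bar> \<le> R * (1 / \<tau>) ^ N" for N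
  proof -
    have "\<exists>R. \<forall>(k, l, \<tau>)\<in>{(k, l, \<tau>). \<tau> > 0}. \<bar>(\<tau> ^ j * sqrt \<tau> * walk_kernel j k \<tau>) * (\<tau> ^ i * sqrt \<tau> * walk_kernel i l \<tau>)
        - (\<Sum>n<N. (1 / \<tau>) ^ n * (\<Sum>m\<le>n. \<kappa> j m (k / sqrt \<tau>) * \<kappa> i (n - m) (l / sqrt \<tau>)))\<bar> \<le> R * (1 / \<tau>) ^ N" for j i
      unfolding split_beta
    proof (rule expansion_product)
      fix N
      obtain R where R: "\<forall>k. \<forall>\<tau>>0. \<bar>\<tau> ^ j * sqrt \<tau> * walk_kernel j k \<tau> - (\<Sum>m<N. (1 / \<tau>) ^ m * \<kappa> j m (k / sqrt \<tau>))\<bar> \<le> R * (1 / \<tau>) ^ N"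
        using exp1 by blast
      show "\<exists>R. \<forall>p\<in>{p. 0 < snd (snd p)}. \<bar>snd (snd p) ^ j * sqrt (snd (snd p)) * walk_kernel j (fst p) (snd (snd p))
          - (\<Sum>m<N. (1 / snd (snd p)) ^ m * \<kappa> j m (fst p / sqrt (snd (snd p))))\<bar> \<le> R * (1 / snd (snd p)) ^ N"
        using R by (intro exI[of _ R]) blast
    next
      fix N
      obtain R where R: "\<forall>k. \<forall>\<tau>>0. \<bar>\<tau> ^ i * sqrt \<tau> * walk_kernel i k \<tau> - (\<Sum>m<N. (1 / \<tau>) ^ m * \<kappa> i m (k / sqrt \<tau>))\<bar> \<le> R * (1 / \<tau>) ^ N"
        using exp1 by blast
      show "\<exists>R. \<forall>p\<in>{p. 0 < snd (snd p)}. \<bar>snd (snd p) ^ i * sqrt (snd (snd p)) * walk_kernel i (fst (snd p)) (snd (snd p))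
          - (\<Sum>m<N. (1 / snd (snd p)) ^ m * \<kappa> i m (fst (snd p) / sqrt (snd (snd p))))\<bar> \<le> R * (1 / snd (snd p)) ^ N"
        using R by (intro exI[of _ R]) blast
    next
      fix m
      show "\<exists>M. \<forall>p\<in>{p. 0 < snd (snd p)}. \<bar>\<kappa> j m (fst p / sqrt (snd (snd p)))\<bar> \<le> M"
        using \<kappa>_bdd[of j m] by blast
    qed auto
    then have "\<forall>j. \<exists>R. \<forall>k l. \<forall>\<tau>>0. \<bar>(\<tau> ^ j * sqrt \<tau> * walk_kernel j k \<tau>) * (\<tau> ^ (J - j) * sqrt \<tau> * walk_kernel (J - j) l \<tau>)
        - (\<Sum>n<N. (1 / \<tau>) ^ n * (\<Sum>m\<le>n. \<kappa> j m (k / sqrt \<tau>) * \<kappa> (J - j) (n - m) (l / sqrt \<tau>)))\<bar> \<le> R * (1 / \<tau>) ^ N"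
      by fastforce
    from choice[OF this] obtain R where R: "\<And>j k l \<tau>. \<tau> > 0 \<Longrightarrow> \<bar>(\<tau> ^ j * sqrt \<tau> * walk_kernel j k \<tau>) * (\<tau> ^ (J - j) * sqrt \<tau> * walk_kernel (J - j) l \<tau>)
        - (\<Sum>n<N. (1 / \<tau>) ^ n * (\<Sum>m\<le>n. \<kappa> j m (k / sqrt \<tau>) * \<kappa> (J - j) (n - m) (l / sqrt \<tau>)))\<bar> \<le> R j * (1 / \<tau>) ^ N"
      by blast
    define R' where "R' = (\<Sum>j\<le>J. real (J choose j) * R j)"
    have bound: "\<bar>\<tau> ^ Suc J * walk_kernel2 J k l \<tau> - (\<Sum>n<N. (1 / \<tau>) ^ n * H n y)\<bar> \<le> R' * (1 / \<tau>) ^ N"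
      if \<tau>: "\<tau> > 0" and y: "y $ 1 = k / sqrt \<tau>" "y $ 2 = l / sqrt \<tau>" for k l \<tau> and y :: "real^2"
    proof -
      define A where "A j = (\<tau> ^ j * sqrt \<tau> * walk_kernel j k \<tau>) * (\<tau> ^ (J - j) * sqrt \<tau> * walk_kernel (J - j) l \<tau>)" for j
      define B where "B j = (\<Sum>n<N. (1 / \<tau>) ^ n * (\<Sum>m\<le>n. \<kappa> j m (k / sqrt \<tau>) * \<kappa> (J - j) (n - m) (l / sqrt \<tau>)))" for j
      have "\<tau> ^ Suc J * walk_kernel2 J k l \<tau> = (\<Sum>j\<le>J. real (J choose j) * A j)"
        unfolding walk_kernel2_def sum_distrib_left
      proof (intro sum.cong refl)
        fix j assume "j \<in> {..J}"
        then have "\<tau> ^ Suc J = \<tau> ^ j * \<tau> ^ (J - j) * (sqrt \<tau> * sqrt \<tau>)"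
          using \<tau> by (simp flip: power_add)
        then show "\<tau> ^ Suc J * (real (J choose j) * walk_kernel j k \<tau> * walk_kernel (J - j) l \<tau>) = real (J choose j) * A j"
          unfolding A_def by (simp only: mult_ac)
      qed
      moreover have "(\<Sum>n<N. (1 / \<tau>) ^ n * H n y) = (\<Sum>j\<le>J. real (J choose j) * B j)"
      proof -
        have "(\<Sum>n<N. (1 / \<tau>) ^ n * H n y) = (\<Sum>n<N. \<Sum>j\<le>J. real (J choose j) * ((1 / \<tau>) ^ n * (\<Sum>m\<le>n. \<kappa> j m (k / sqrt \<tau>) * \<kappa> (J - j) (n - m) (l / sqrt \<tau>))))"
          unfolding H_def y sum_distrib_left[of "(1 / \<tau>) ^ _" _ "{..J}"] by (simp only: mult.left_commute)
        also have "\<dots> = (\<Sum>j\<le>J. \<Sum>n<N. real (J choose j) * ((1 / \<tau>) ^ n * (\<Sum>m\<le>n. \<kappa> j m (k / sqrt \<tau>) * \<kappa> (J - j) (n - m) (l / sqrt \<tau>))))"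
          by (rule sum.swap)
        finally show ?thesis by (simp only: B_def sum_distrib_left[of _ _ "{..<N}"])
      qed
      ultimately have "\<tau> ^ Suc J * walk_kernel2 J k l \<tau> - (\<Sum>n<N. (1 / \<tau>) ^ n * H n y) = (\<Sum>j\<le>J. real (J choose j) * (A j - B j))"
        by (simp only: sum_subtractf[symmetric] right_diff_distrib)
      moreover have "\<bar>\<Sum>j\<le>J. real (J choose j) * (A j - B j)\<bar> \<le> (\<Sum>j\<le>J. real (J choose j) * R j * (1 / \<tau>) ^ N)"
      proof (rule order_trans[OF sum_abs], rule sum_mono)
        fix j
        have "\<bar>A j - B j\<bar> \<le> R j * (1 / \<tau>) ^ N" unfolding A_def B_def by (rule R[OF \<tau>])
        then show "\<bar>real (J choose j) * (A j - B j)\<bar> \<le> real (J choose j) * R j * (1 / \<tau>) ^ N"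
          unfolding abs_mult mult.assoc by (simp add: mult_left_mono)
      qed
      ultimately show ?thesis by (simp only: R'_def sum_distrib_right)
    qed
    show ?thesis
    proof (intro exI[of _ "\<bar>R'\<bar>"] conjI allI impI)
      fix k l \<tau> :: real and y :: "real^2" assume \<tau>: "0 < \<tau>" and y: "y $ 1 = k / sqrt \<tau> \<and> y $ 2 = l / sqrt \<tau>"
      have "R' * (1 / \<tau>) ^ N \<le> \<bar>R'\<bar> * (1 / \<tau>) ^ N" using \<tau> by (intro mult_right_mono) auto
      then show "\<bar>\<tau> ^ Suc J * walk_kernel2 J k l \<tau> - (\<Sum>n<N. (1 / \<tau>) ^ n * H n y)\<bar> \<le> \<bar>R'\<bar> * (1 / \<tau>) ^ N"
        using bound[OF \<tau>, of y k l] y by linarith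
    qed simp
  qed
  show ?thesis using H0 lin rem by blast
qed

theorem theorem3p1:
  fixes J :: nat
  shows "\<exists>H :: nat \<Rightarrow> real^2 \<Rightarrow> real.
    H 0 = (laplacian ^^ J) heat_profile \<and>
    (\<forall>n\<ge>1. lin_comb_of_partials (H n) heat_profile) \<and>
    (\<forall>t0>0. \<forall>N\<ge>1. \<exists>R\<ge>0. \<forall>\<epsilon>>0. \<forall>u. first_green_function \<epsilon> u \<longrightarrow>
      (\<forall>x \<in> grid \<epsilon>. \<forall>t \<ge> t0 * \<epsilon>\<^sup>2.
         (\<forall>j<J. (deriv ^^ j) (u x) differentiable (at t)) \<and>
         \<bar>(deriv ^^ J) (u x) t
            - (\<Sum>n<N. \<epsilon> ^ (2 * n) / t ^ (n + 1 + J) * H n (x /\<^sub>R sqrt t))\<bar>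
          \<le> \<epsilon> ^ (2 * N) * R / t ^ (N + 1 + J)))"
proof -
  obtain H where H: "H 0 = (laplacian ^^ J) heat_profile" "\<forall>n\<ge>1. lin_comb_of_partials (H n) heat_profile"
    and rem: "\<And>N. \<exists>R\<ge>0. \<forall>k l. \<forall>\<tau>>0. \<forall>y :: real^2. y $ 1 = k / sqrt \<tau> \<and> y $ 2 = l / sqrt \<tau> \<longrightarrow>
      \<bar>\<tau> ^ Suc J * walk_kernel2 J k l \<tau> - (\<Sum>n<N. (1 / \<tau>) ^ n * H n y)\<bar> \<le> R * (1 / \<tau>) ^ N"
    using walk_kernel2_expansion[of J] by blast
  have main: "\<exists>R\<ge>0. \<forall>\<epsilon>>0. \<forall>u. first_green_function \<epsilon> u \<longrightarrow>
      (\<forall>x \<in> grid \<epsilon>. \<forall>t \<ge> t0 * \<epsilon>\<^sup>2.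
         (\<forall>j<J. (deriv ^^ j) (u x) differentiable (at t)) \<and>
         \<bar>(deriv ^^ J) (u x) t
            - (\<Sum>n<N. \<epsilon> ^ (2 * n) / t ^ (n + 1 + J) * H n (x /\<^sub>R sqrt t))\<bar>
          \<le> \<epsilon> ^ (2 * N) * R / t ^ (N + 1 + J))" if t0: "t0 > 0" for t0 N
  proof -
    obtain R where R0: "R \<ge> 0" and R: "\<And>k l \<tau> y. \<tau> > 0 \<Longrightarrow> y $ 1 = k / sqrt \<tau> \<Longrightarrow> y $ 2 = l / sqrt \<tau> \<Longrightarrow>
      \<bar>\<tau> ^ Suc J * walk_kernel2 J k l \<tau> - (\<Sum>n<N. (1 / \<tau>) ^ n * H n y)\<bar> \<le> R * (1 / \<tau>) ^ N"
      using rem[of N] by blast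
    show ?thesis
    proof (intro exI[of _ R] conjI R0 allI impI ballI)
      fix \<epsilon> u x t assume \<epsilon>: "(0::real) < \<epsilon>" and u: "first_green_function \<epsilon> u" and x: "x \<in> grid \<epsilon>" and t: "t0 * \<epsilon>\<^sup>2 \<le> t"
      have tpos: "t > 0"
      proof -
        have "0 < t0 * \<epsilon>\<^sup>2" using t0 \<epsilon> by simp
        then show ?thesis using t by linarith
      qed
      have formula: "u x s = green_formula \<epsilon> 0 x s" if "s > 0" for s
        using green_function_eq_formula[OF \<epsilon> u x] that by simp
      have deriv: "(deriv ^^ j) (u x) t = green_formula \<epsilon> j x t" "(deriv ^^ j) (u x) differentiable (at t)" for j
        by (rule iterated_deriv_eq[where V = "\<lambda>n. green_formula \<epsilon> n x"],
            erule formula, rule green_formula_has_derivative, rule tpos)+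
      show "(deriv ^^ j) (u x) differentiable (at t)" for j by (rule deriv(2))
      define \<tau> where "\<tau> = t / \<epsilon>\<^sup>2"
      have \<tau>: "\<tau> > 0" using tpos \<epsilon> by (simp add: \<tau>_def)
      have inv: "1 / \<tau> = \<epsilon>\<^sup>2 / t" by (simp add: \<tau>_def)
      have pow: "\<epsilon> ^ (2 * n) = (\<epsilon>\<^sup>2) ^ n" for n by (rule power_mult)
      define W where "W = walk_kernel2 J (x $ 1 / \<epsilon>) (x $ 2 / \<epsilon>) \<tau>"
      define y where "y = x /\<^sub>R sqrt t"
      have "sqrt \<tau> = sqrt t / \<epsilon>" using \<epsilon> by (simp add: \<tau>_def real_sqrt_divide)
      then have y: "y $ i = x $ i / \<epsilon> / sqrt \<tau>" for i
        using \<epsilon> by (simp add: y_def divide_inverse mult_ac)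
      have d: "(deriv ^^ J) (u x) t = \<tau> ^ Suc J * W / t ^ Suc J"
        unfolding deriv(1) green_formula_def W_def[symmetric] \<tau>_def[symmetric]
        using tpos by (simp add: \<tau>_def power_divide del: power_Suc)
      have s: "(\<Sum>n<N. \<epsilon> ^ (2 * n) / t ^ (n + 1 + J) * H n y) = (\<Sum>n<N. (1 / \<tau>) ^ n * H n y) / t ^ Suc J"
        unfolding sum_divide_distrib inv pow by (intro sum.cong refl) (simp add: power_divide power_add mult_ac)
      have "\<bar>(deriv ^^ J) (u x) t - (\<Sum>n<N. \<epsilon> ^ (2 * n) / t ^ (n + 1 + J) * H n y)\<bar>
         = \<bar>\<tau> ^ Suc J * W - (\<Sum>n<N. (1 / \<tau>) ^ n * H n y)\<bar> / t ^ Suc J"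
        unfolding d s diff_divide_distrib[symmetric] abs_divide using tpos by simp
      also have "\<dots> \<le> R * (1 / \<tau>) ^ N / t ^ Suc J"
        unfolding W_def using tpos by (intro divide_right_mono R \<tau> y) simp
      also have "\<dots> = \<epsilon> ^ (2 * N) * R / t ^ (N + 1 + J)"
        unfolding inv pow by (simp add: power_divide power_add mult_ac)
      finally show "\<bar>(deriv ^^ J) (u x) t - (\<Sum>n<N. \<epsilon> ^ (2 * n) / t ^ (n + 1 + J) * H n (x /\<^sub>R sqrt t))\<bar>
          \<le> \<epsilon> ^ (2 * N) * R / t ^ (N + 1 + J)" unfolding y_def .
    qed
  qed
  show ?thesis by (rule exI[of _ H]) (use H main in blast)
qed

end
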